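(* Let $q$ be a complex number with $0<|q|<1$. (1) Define sequences $(P_m)_{m\ge -1}$, $(Q_m)_{m\ge -1}$ by $$P_m=(1+q+q^{2m})P_{m-1}-qP_{m-2}\quad(m\ge 2),\qquad P_{-1}=0,\ P_0=1,\ P_1=1+q+q^2,$$ $$Q_m=(1+q+q^{2m})Q_{m-1}-qQ_{m-2}\quad(m\ge 2),\qquad Q_{-1}=1,\ Q_0=1,\ Q_1=1+q^2.$$ Then for every integer $m\ge 0$, $$\sum_{n=0}^{\infty}\frac{q^{n^2+(2m+1)n}}{(q;q)_{2n+1}}=\frac{q^{-m}(q^3,q^7,q^{10};q^{10})_{\infty}(q^4,q^{16};q^{20})_{\infty}}{(q;q)_{\infty}}Q_{m-1}-\frac{q^{-m}(q,q^9,q^{10};q^{10})_{\infty}(q^8,q^{12};q^{20})_{\infty}}{(q;q)_{\infty}}P_{m-1}.$$ (2) Define sequences $(A_m)_{m\ge 0}$, $(B_m)_{m\ge 0}$ by $$A_m=(1+q+q^{2m-1})A_{m-1}-qA_{m-2}\quad(m\ge 2),\qquad A_0=1,\ A_1=1+q,$$ $$B_m=(1+q+q^{2m-1})B_{m-1}-qB_{m-2}\quad(m\ge 2),\qquad B_0=0,\ B_1=q.$$ Then for every integer $m\ge 0$, $$\sum_{n=0}^{\infty}\frac{q^{n^2+(2m+1)n}}{(q;q)_{2n}}=\frac{(q,q^9,q^{10};q^{10})_{\infty}(q^8,q^{12};q^{20})_{\infty}}{(q;q)_{\infty}}A_m-\frac{(q^3,q^7,q^{10};q^{10})_{\infty}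(q^4,q^{16};q^{20})_{\infty}}{(q;q)_{\infty}}B_m.$$
   Context: For $|p|<1$, $(a;p)_\infty=\prod_{k=0}^{\infty}(1-ap^k)$ and, for an integer $n\ge 0$, $(a;p)_n=\prod_{k=0}^{n-1}(1-ap^k)$. Multiple $q$-shifted factorials are products: $(a_1,\dots,a_r;p)_\infty=(a_1;p)_\infty\cdots(a_r;p)_\infty$. *)

theory Defs
  imports "HOL-Analysis.Analysis"
begin

definition qfac :: "complex \<Rightarrow> complex \<Rightarrow> nat \<Rightarrow> complex" where
  "qfac a p n = (\<Prod>k<n. 1 - a * p ^ k)"

(* Meaningful for norm p < 1, where the infinite product converges. *)
definition qfac_inf :: "complex \<Rightarrow> complex \<Rightarrow> complex" where
  "qfac_inf a p = (\<Prod>k. 1 - a * p ^ k)"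

definition qfacs_inf :: "complex list \<Rightarrow> complex \<Rightarrow> complex" where
  "qfacs_inf as p = (\<Prod>a\<leftarrow>as. qfac_inf a p)"

end

(*
  Both series satisfy first-order relations that couple them, so everything reduces to m = 0.
  There, Schur-type polynomial identities (alternating sums of Gaussian binomials that telescope
  under the q-Pascal rules) expand 1/(q;q)_{2n+1} and 1/(q;q)_{2n} over the kernel
  1/((q;q)_{n-r} (q;q)_{n+r+1}); summing the kernel against q^(n^2+n) by Durfee rectangles, as in
  Bailey's lemma, turns both series into theta series with exponents 15 j^2 + ..., which the
  quintuple product identity with base q^10 factors. The quintuple product is the limit of a
  terminating identity with a Wilf-Zeilberger proof.
*)
theory Submission
  imports Defs
begin

section \<open>Shifted factorials and Gaussian binomials\<close>

text \<open>The exponents 6 j^2 + j and 6 j^2 + 5 j + 1 are the pentagonal numbers k (3 k - 1) / 2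
  at k = -2 j and k = 2 j + 1, so the Schur-type identities are finite forms of Euler's pentagonal
  number theorem. Their binomials in row 2 n + 1 are taken at n - r with r = 3 j, -3 j or 3 j + 1,
  and the kernel sum contributes r^2 + r; hence 6 j^2 + 9 j^2 = 15 j^2. The quintuple product with
  base q^10 also has leading exponent 15 k^2, and its arguments z = q^3 and z = q give the linear
  terms 4 k and -2 k. The obstacle is the even series. Summing by Durfee rectangles ties the weight
  q^(n^2 + n) to the offset 2 r + 1 between the two factors of the kernel, that is, to the odd row 2
  n + 1 of Gaussian binomials. Row 2 n, natural for 1/(q;q)_{2n}, does not fit; instead an odd-row
  sum with value 1 - q^(2n+1) is needed, and it rests on an extra identity with value q^n.\<close>

lemma qfac_0 [simp]: "qfac a p 0 = 1"
  by (simp add: qfac_def)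

lemma qfac_Suc: "qfac a p (Suc n) = qfac a p n * (1 - a * p ^ n)"
  by (simp add: qfac_def)

lemma qfac_Suc_shift: "qfac a p (Suc n) = (1 - a) * qfac (a * p) p n"
  unfolding qfac_def by (subst prod.lessThan_Suc_shift) (simp add: mult.assoc)

text \<open>Reciprocal of (q;q)_k continued by 0 to negative k, as 1/Gamma vanishes at the poles.
  Binomials built from it vanish outside 0..N, so finite sums can run over all integers without
  boundary terms.\<close>

definition rqfac :: "complex \<Rightarrow> int \<Rightarrow> complex" where
  "rqfac q k = (if k < 0 then 0 else 1 / qfac q q (nat k))"

definition qbin :: "complex \<Rightarrow> nat \<Rightarrow> int \<Rightarrow> complex" where
  "qbin q N k = qfac q q N * rqfac q k * rqfac q (int N - k)"

lemma rqfac_of_nat [simp]: "rqfac q (int n) = 1 / qfac q q n"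
  by (simp add: rqfac_def)

lemma rqfac_neg [simp]: "k < 0 \<Longrightarrow> rqfac q k = 0"
  by (simp add: rqfac_def)

lemma qbin_sym: "qbin q N (int N - k) = qbin q N k"
  by (simp add: qbin_def)

lemma qbin_eq_0: "k < 0 \<or> int N < k \<Longrightarrow> qbin q N k = 0"
  by (auto simp: qbin_def)

lemma qbin_0 [simp]: "qbin q 0 k = (if k = 0 then 1 else 0)"
proof (cases "k = 0")
  case False
  then have "k < 0 \<or> 0 < k"
    by linarith
  then show ?thesis
    using False by (auto simp: qbin_eq_0)
qed (simp add: qbin_def rqfac_def)

text \<open>An involution reindexes \<open>v\<close> without changing its total, so the added
  difference contributes 0. This performs every cancellation of remainders after a Pascal step;
  \<open>v\<close> is never evaluated.\<close>

lemma has_sum_add_reindex_diff: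
  fixes f v :: "'a \<Rightarrow> complex"
  assumes "(f has_sum s) UNIV" and "v summable_on UNIV" and "\<And>j. \<sigma> (\<sigma> j) = j"
    and "\<And>j. g j = f j + v (\<sigma> j) - v j"
  shows "(g has_sum s) UNIV"
proof -
  obtain t where t: "(v has_sum t) UNIV"
    using assms(2) by (auto simp: summable_on_def)
  have "bij \<sigma>"
    using assms(3) by (metis involuntory_imp_bij)
  then have "((\<lambda>j. v (\<sigma> j)) has_sum t) UNIV"
    using t by (simp add: has_sum_reindex_bij_betw)
  then have "((\<lambda>j. f j + v (\<sigma> j) + - v j) has_sum (s + t + - t)) UNIV"
    using assms(1) t by (intro has_sum_add has_sum_uminusI)
  then show ?thesis
    by (simp add: assms(4)[abs_def])
qed

lemma summable_on_qbin:
  "(\<lambda>j. c j * qbin q N (a - 3 * j)) summable_on UNIV"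
proof -
  have "{j. qbin q N (a - 3 * j) \<noteq> 0} \<subseteq> {(a - int N) div 3 .. a div 3}"
    using qbin_eq_0[of _ N q] by (force simp: not_less)
  then have fin: "finite {j. qbin q N (a - 3 * j) \<noteq> 0}"
    using finite_subset by blast
  have "((\<lambda>j. c j * qbin q N (a - 3 * j)) has_sum 
      (\<Sum>j\<in>{j. qbin q N (a - 3 * j) \<noteq> 0}. c j * qbin q N (a - 3 * j))) UNIV"
    by (rule has_sum_finite_neutralI[OF fin]) auto
  then show ?thesis
    by (rule has_sum_imp_summable)
qed

section \<open>Series and products\<close>

text \<open>Tannery's theorem, obtained by reading infinite sums as integrals over counting measure.
  It justifies both later passages to the limit: in the Durfee rectangles and in the quintuple
  product.\<close>

lemma infsum_dominated_convergence:
  fixes f :: "nat \<Rightarrow> 'a \<Rightarrow> complex" and w :: "'a \<Rightarrow> real"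
  assumes "w summable_on UNIV" and "\<And>n x. norm (f n x) \<le> w x" and "\<And>x. (\<lambda>n. f n x) \<longlonglongrightarrow> g x"
  shows "g summable_on UNIV" and "(\<lambda>n. infsum (f n) UNIV) \<longlonglongrightarrow> infsum g UNIV"
proof -
  have w0: "0 \<le> w x" for x
    using assms(2)[of 0 x] norm_ge_zero order_trans by blast
  have g: "norm (g x) \<le> w x" for x
    using assms(2,3) by (intro Lim_bounded[OF tendsto_norm[OF assms(3)], of 0]) auto
  have "(\<lambda>x. norm (w x)) summable_on UNIV"
    using assms(1) w0 by simp
  then have w: "integrable (count_space UNIV) w"
    using abs_summable_equivalent[of w UNIV] by (simp add: abs_summable_on_def)
  have ng: "(\<lambda>x. norm (g x)) summable_on UNIV"
    using assms(1) g by (rule summable_on_comparison_test) auto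
  have nf: "(\<lambda>x. norm (f n x)) summable_on UNIV" for n
    using assms(1) assms(2)[of n] by (rule summable_on_comparison_test) auto
  show "g summable_on UNIV"
    using ng by (rule abs_summable_summable)
  have eq: "infsum h UNIV = integral\<^sup>L (count_space UNIV) h"
    if "(\<lambda>x. norm (h x)) summable_on UNIV" for h :: "'a \<Rightarrow> complex"
    using infsetsum_infsum[of h UNIV] that abs_summable_equivalent[of h UNIV]
    by (simp add: infsetsum_def)
  have "(\<lambda>n. integral\<^sup>L (count_space UNIV) (f n)) \<longlonglongrightarrow> integral\<^sup>L (count_space UNIV) g"
    by (rule integral_dominated_convergence[where w = w]) (use w assms in auto)
  then show "(\<lambda>n. infsum (f n) UNIV) \<longlonglongrightarrow> infsum g UNIV"
    using eq[OF ng] eq[OF nf] by simp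
qed

lemma summable_on_int_from_nat:
  fixes f :: "int \<Rightarrow> real"
  assumes "(\<lambda>n. f (int n)) summable_on UNIV" and "(\<lambda>n. f (- int n)) summable_on UNIV"
  shows "f summable_on UNIV"
proof -
  have "f summable_on {0..}"
    using assms(1) by (subst summable_on_reindex_bij_witness[of _ int nat UNIV "\<lambda>n. f (int n)"]) auto
  moreover have "f summable_on {..0}"
    using assms(2)
    by (subst summable_on_reindex_bij_witness[of _ "\<lambda>n. - int n" "\<lambda>j. nat (- j)" UNIV "\<lambda>n. f (- int n)"]) auto
  then have "f summable_on {..<0}"
    by (rule summable_on_subset_banach) auto
  ultimately have "f summable_on {0..} \<union> {..<0}"
    by (rule summable_on_Un_disjoint) auto
  moreover have "{0..} \<union> {..<0} = (UNIV :: int set)"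
    by auto
  ultimately show ?thesis
    by simp
qed

lemma summable_on_power_abs_int:
  fixes r :: real
  assumes "0 \<le> r" "r < 1"
  shows "(\<lambda>j::int. r ^ nat \<bar>j\<bar>) summable_on UNIV"
proof -
  have "(\<lambda>n. r ^ n) summable_on UNIV"
    using assms by (intro norm_summable_imp_summable_on) simp
  then show ?thesis
    by (intro summable_on_int_from_nat) simp_all
qed

lemma convergent_prod_qfac:
  fixes a p :: complex
  assumes "norm p < 1"
  shows "convergent_prod (\<lambda>k. 1 - a * p ^ k)"
proof -
  have "norm (1 - a * p ^ k - 1) = norm a * norm p ^ k" for k
    by (simp add: norm_mult norm_power)
  moreover have "summable (\<lambda>k. norm a * norm p ^ k)"
    using assms by (intro summable_mult summable_geometric) simp
  ultimately have "summable (\<lambda>k. norm (1 - a * p ^ k - 1))"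
    by (simp only:)
  then show ?thesis
    by (intro abs_convergent_prod_imp_convergent_prod summable_imp_abs_convergent_prod)
qed

lemma qfac_tendsto:
  assumes "norm p < 1"
  shows "(\<lambda>n. qfac a p n) \<longlonglongrightarrow> qfac_inf a p"
  using convergent_prod_LIMSEQ[OF convergent_prod_qfac[OF assms, of a]]
  by (simp add: qfac_def qfac_inf_def LIMSEQ_lessThan_iff_atMost[of "\<lambda>A. prod _ A"])

lemma qfac_inf_neq_0:
  assumes "norm p < 1" and "\<And>k. a * p ^ k \<noteq> 1"
  shows "qfac_inf a p \<noteq> 0"
  unfolding qfac_inf_def using assms by (intro prodinf_nonzero convergent_prod_qfac) auto

lemma qfac_bounded:
  assumes "norm p < 1"
  obtains C where "C > 0" "\<And>n. norm (qfac a p n) \<le> C"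
  using qfac_tendsto[OF assms, of a] by (metis BseqE convergentI convergent_imp_Bseq)

lemma inverse_qfac_bounded:
  assumes "norm p < 1" and "\<And>k. a * p ^ k \<noteq> 1"
  obtains C where "C > 0" "\<And>n. norm (1 / qfac a p n) \<le> C"
proof -
  have "(\<lambda>n. 1 / qfac a p n) \<longlonglongrightarrow> 1 / qfac_inf a p"
    using assms by (intro tendsto_divide tendsto_const qfac_tendsto qfac_inf_neq_0)
  then show ?thesis
    using that by (metis BseqE convergentI convergent_imp_Bseq)
qed

context
  fixes q :: complex
  assumes q0: "q \<noteq> 0" and q1: "norm q < 1"
begin

lemma power_neq_1: "n > 0 \<Longrightarrow> q ^ n \<noteq> 1"
  using q1 power_less_one_iff[of "norm q" n] by (metis norm_ge_zero norm_one norm_power less_irrefl not_gr_zero)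

lemma qfac_neq_0: "qfac q q n \<noteq> 0"
  using power_neq_1[of "Suc _"] by (auto simp: qfac_def)

lemma powi_mult: "q powi a * q powi b = q powi (a + b)"
  using q0 by (simp add: power_int_add)

text \<open>At k = 0 the factor 1 - q^0 = 0 agrees with the value 0 assigned at -1, so the recursion
  of (q;q)_k survives at every integer. This frees the Pascal rules of range conditions.\<close>

lemma rqfac_pred: "rqfac q (k - 1) = (1 - q powi k) * rqfac q k"
proof -
  consider "k < 0" | "k = 0" | n where "k = int (Suc n)"
    by (metis int_cases negative_zless not0_implies_Suc of_nat_0)
  then show ?thesis
  proof cases
    case 3
    then show ?thesis
      using qfac_neq_0[of "Suc n"] qfac_neq_0[of n]
      by (simp add: rqfac_def nat_add_distrib qfac_Suc power_int_add q0)
  qed auto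
qed

lemma qbin_Suc:
  "qbin q (Suc N) k = qbin q N k + q powi (int N + 1 - k) * qbin q N (k - 1)"
  and qbin_Suc':
  "qbin q (Suc N) k = qbin q N (k - 1) + q powi k * qbin q N k"
proof -
  \<comment> \<open>With \<open>R\<close> factored out, every binomial in either rule is a multiple
    of \<open>rqfac q k * R\<close>; what remains is a polynomial identity in the two powers whose
    product is q^(N+1).\<close>
  define R where "R = rqfac q (int N + 1 - k)"
  have R: "rqfac q (int N - k) = (1 - q powi (int N + 1 - k)) * R"
    using rqfac_pred[of "int N + 1 - k"] by (simp add: R_def)
  have e: "int (Suc N) - k = int N + 1 - k" "int N - (k - 1) = int N + 1 - k"
    by simp_all
  have p: "q * q ^ N = q powi (int N + 1 - k) * q powi k"
    unfolding powi_mult by (simp add: power_int_add q0)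
  show "qbin q (Suc N) k = qbin q N k + q powi (int N + 1 - k) * qbin q N (k - 1)"
    unfolding qbin_def qfac_Suc e R p rqfac_pred[of k] R_def[symmetric]
    by (simp add: algebra_simps)
  show "qbin q (Suc N) k = qbin q N (k - 1) + q powi k * qbin q N k"
    unfolding qbin_def qfac_Suc e R p rqfac_pred[of k] R_def[symmetric]
    by (simp add: algebra_simps)
qed

section \<open>Schur-type identities for alternating sums of Gaussian binomials\<close>

text \<open>The parity steps E(n) \<rightarrow> O(n) \<rightarrow> E(n + 1) use one q-Pascal rule each, chosen so that the
  remainders cancel under j \<mapsto> - 1 - j and j \<mapsto> - j respectively.\<close>

lemma
  shows schur_even: "((\<lambda>j. q powi (6 * j\<^sup>2 + j) * qbin q (2 * n) (int n - 3 * j)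
           - q powi (6 * j\<^sup>2 + 5 * j + 1) * qbin q (2 * n) (int n - 3 * j - 1)) has_sum 1) UNIV"
      (is "(?E n has_sum 1) UNIV")
    and schur_odd: "((\<lambda>j. q powi (6 * j\<^sup>2 + j) * qbin q (2 * n + 1) (int n - 3 * j)
           - q powi (6 * j\<^sup>2 + 5 * j + 1) * qbin q (2 * n + 1) (int n - 3 * j - 1)) has_sum 1) UNIV"
      (is "(?O n has_sum 1) UNIV")
proof -
  have step: "(?O n has_sum 1) UNIV" if "(?E n has_sum 1) UNIV" for n
  proof (rule has_sum_add_reindex_diff[OF that, where \<sigma> = "\<lambda>j. -1 - j"])
    let ?v = "\<lambda>j::int. q powi (6 * j\<^sup>2 + 8 * j + n + 3) * qbin q (2 * n) (int n - 2 - 3 * j)"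
    show "?v summable_on UNIV"
      by (rule summable_on_qbin)
    fix j :: int
    have s: "qbin q (2 * n) (int n - 2 - 3 * (-1 - j)) = qbin q (2 * n) (int n - 3 * j - 1)"
      using qbin_sym[of q "2 * n" "int n - 3 * j - 1"] by (simp add: algebra_simps)
    have e: "6 * (-1 - j)\<^sup>2 + 8 * (-1 - j) + int n + 3 = 6 * j\<^sup>2 + 4 * j + int n + 1"
      by (simp add: power2_eq_square algebra_simps)
    have p: "q powi (6 * j\<^sup>2 + j) * q powi (int n + 1 + 3 * j) = q powi (6 * j\<^sup>2 + 4 * j + int n + 1)"
      "q powi (6 * j\<^sup>2 + 5 * j + 1) * q powi (int n + 2 + 3 * j) = q powi (6 * j\<^sup>2 + 8 * j + n + 3)"
      by (simp_all add: powi_mult algebra_simps)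
    have b: "qbin q (2 * n + 1) (int n - 3 * j) = qbin q (2 * n) (int n - 3 * j)
        + q powi (int n + 1 + 3 * j) * qbin q (2 * n) (int n - 3 * j - 1)"
      "qbin q (2 * n + 1) (int n - 3 * j - 1) = qbin q (2 * n) (int n - 3 * j - 1)
        + q powi (int n + 2 + 3 * j) * qbin q (2 * n) (int n - 2 - 3 * j)"
      using qbin_Suc[of "2 * n" "int n - 3 * j"] qbin_Suc[of "2 * n" "int n - 3 * j - 1"]
      by (simp_all add: algebra_simps)
    show "?O n j = ?E n j + ?v (-1 - j) - ?v j"
      unfolding s e b p[symmetric] by (simp add: algebra_simps)
  qed simp
  have even: "(?E n has_sum 1) UNIV" for n
  proof (induction n)
    case 0
    have "?E 0 j = 0" if "j \<noteq> 0" for j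
      using that by simp
    moreover have "?E 0 0 = 1"
      by simp
    ultimately show ?case
      by (intro has_sum_finite_neutralI[where B = "{0}"]) auto
  next
    case (Suc n)
    show ?case
    proof (rule has_sum_add_reindex_diff[OF step[OF Suc.IH], where \<sigma> = "\<lambda>j. - j"])
      let ?v = "\<lambda>j::int. q powi (6 * j\<^sup>2 + 2 * j + n + 1) * qbin q (2 * n + 1) (int n - 3 * j)"
      show "?v summable_on UNIV"
        by (rule summable_on_qbin)
      fix j :: int
      have s: "qbin q (2 * n + 1) (int n - 3 * - j) = qbin q (2 * n + 1) (int n + 1 - 3 * j)"
        using qbin_sym[of q "2 * n + 1" "int n + 1 - 3 * j"] by (simp add: algebra_simps)
      have p: "q powi (6 * j\<^sup>2 + j) * q powi (int n + 1 - 3 * j) = q powi (6 * (-j)\<^sup>2 + 2 * (-j) + int n + 1)"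
        "q powi (6 * j\<^sup>2 + 5 * j + 1) * q powi (int n - 3 * j) = q powi (6 * j\<^sup>2 + 2 * j + n + 1)"
        by (simp_all add: powi_mult algebra_simps)
      have b: "qbin q (2 * Suc n) (int (Suc n) - 3 * j) = qbin q (2 * n + 1) (int n - 3 * j)
          + q powi (int n + 1 - 3 * j) * qbin q (2 * n + 1) (int n + 1 - 3 * j)"
        "qbin q (2 * Suc n) (int (Suc n) - 3 * j - 1) = qbin q (2 * n + 1) (int n - 3 * j - 1)
          + q powi (int n - 3 * j) * qbin q (2 * n + 1) (int n - 3 * j)"
        using qbin_Suc'[of "2 * n + 1" "int n + 1 - 3 * j"] qbin_Suc'[of "2 * n + 1" "int n - 3 * j"]
        by (simp_all add: algebra_simps)
      show "?E (Suc n) j = ?O n j + ?v (- j) - ?v j"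
        unfolding s b p[symmetric] by (simp add: algebra_simps)
    qed simp
  qed
  show "(?E n has_sum 1) UNIV" "(?O n has_sum 1) UNIV"
    using even step by blast+
qed

text \<open>Supplies the correction term in \<open>schur_odd'\<close>. For n = m + 1 the two
  binomials are expanded by different Pascal rules so that both contain
  \<open>qbin q (2 * m + 1) (int m - 3 * j)\<close>; it cancels in the difference, and q^n times a
  rearranged \<open>schur_odd\<close> remains.\<close>

lemma schur_shifted:
  "((\<lambda>j. q powi (6 * j\<^sup>2 + 2 * j) * (qbin q (2 * n) (int n - 3 * j) - qbin q (2 * n) (int n - 3 * j - 1)))
     has_sum q ^ n) UNIV" (is "(?G n has_sum _) _")
proof (cases n)
  case 0
  have "?G 0 j = 0" if "j \<noteq> 0" for j
    using that by simp
  moreover have "?G 0 0 = 1"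
    by simp
  ultimately show ?thesis
    unfolding 0 by (intro has_sum_finite_neutralI[where B = "{0}"]) auto
next
  case (Suc m)
  \<comment> \<open>The summand of \<open>schur_odd\<close> with its first term reflected by j to
    -j, so the sum is still 1.\<close>
  let ?g = "\<lambda>j. q powi (6 * j\<^sup>2 - j) * qbin q (2 * m + 1) (int m + 1 - 3 * j)
    - q powi (6 * j\<^sup>2 + 5 * j + 1) * qbin q (2 * m + 1) (int m - 3 * j - 1)"
  have "(?g has_sum 1) UNIV"
  proof (rule has_sum_add_reindex_diff[OF schur_odd[of m], where \<sigma> = "\<lambda>j. - j"])
    let ?v = "\<lambda>j. q powi (6 * j\<^sup>2 + j) * qbin q (2 * m + 1) (int m - 3 * j)"
    show "?v summable_on UNIV"
      by (rule summable_on_qbin)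
    fix j :: int
    have s: "qbin q (2 * m + 1) (int m - 3 * - j) = qbin q (2 * m + 1) (int m + 1 - 3 * j)"
      using qbin_sym[of q "2 * m + 1" "int m + 1 - 3 * j"] by (simp add: algebra_simps)
    show "?g j = (q powi (6 * j\<^sup>2 + j) * qbin q (2 * m + 1) (int m - 3 * j)
           - q powi (6 * j\<^sup>2 + 5 * j + 1) * qbin q (2 * m + 1) (int m - 3 * j - 1)) + ?v (- j) - ?v j"
      unfolding s by (simp add: algebra_simps)
  qed simp
  then have "((\<lambda>j. q ^ n * ?g j) has_sum q ^ n * 1) UNIV"
    by (intro has_sum_cmult_right)
  moreover have "?G n j = q ^ n * ?g j" for j
  proof -
    have p: "q powi (6 * j\<^sup>2 + 2 * j) * q powi (int m + 1 - 3 * j) = q powi int n * q powi (6 * j\<^sup>2 - j)"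
      "q powi (6 * j\<^sup>2 + 2 * j) * q powi (int m + 2 + 3 * j) = q powi int n * q powi (6 * j\<^sup>2 + 5 * j + 1)"
      unfolding powi_mult using Suc by (simp_all add: algebra_simps)
    have b: "qbin q (2 * n) (int n - 3 * j) = qbin q (2 * m + 1) (int m - 3 * j)
        + q powi (int m + 1 - 3 * j) * qbin q (2 * m + 1) (int m + 1 - 3 * j)"
      "qbin q (2 * n) (int n - 3 * j - 1) = qbin q (2 * m + 1) (int m - 3 * j)
        + q powi (int m + 2 + 3 * j) * qbin q (2 * m + 1) (int m - 3 * j - 1)"
      using Suc qbin_Suc'[of "2 * m + 1" "int m + 1 - 3 * j"] qbin_Suc[of "2 * m + 1" "int m - 3 * j"]
      by (simp_all add: algebra_simps)
    have "?G n j = q powi (6 * j\<^sup>2 + 2 * j) * q powi (int m + 1 - 3 * j) * qbin q (2 * m + 1) (int m + 1 - 3 * j)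
      - q powi (6 * j\<^sup>2 + 2 * j) * q powi (int m + 2 + 3 * j) * qbin q (2 * m + 1) (int m - 3 * j - 1)"
      unfolding b by (simp add: algebra_simps)
    then show ?thesis
      unfolding p by (simp add: algebra_simps)
  qed
  ultimately show ?thesis
    by simp
qed

text \<open>Division by (q;q)_{2n+1} leaves 1/(q;q)_{2n}, which makes this the odd-row expansion for
  the even series. The Pascal rules reduce it to row 2 n: the summand of \<open>schur_even\<close>
  minus q^(n+1) times that of \<open>schur_shifted\<close>, up to a reflection.\<close>

lemma schur_odd':
  "((\<lambda>j. q powi (6 * j\<^sup>2 + j) * qbin q (2 * n + 1) (int n + 3 * j)
        - q powi (6 * j\<^sup>2 + 5 * j + 1) * qbin q (2 * n + 1) (int n - 3 * j))
     has_sum 1 - q ^ (2 * n + 1)) UNIV" (is "(?T has_sum _) _")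
proof -
  let ?f = "\<lambda>j. (q powi (6 * j\<^sup>2 + j) * qbin q (2 * n) (int n - 3 * j)
           - q powi (6 * j\<^sup>2 + 5 * j + 1) * qbin q (2 * n) (int n - 3 * j - 1))
       + - (q ^ (n + 1) * (q powi (6 * j\<^sup>2 + 2 * j) *
           (qbin q (2 * n) (int n - 3 * j) - qbin q (2 * n) (int n - 3 * j - 1))))"
  have "(?f has_sum 1 + - (q ^ (n + 1) * q ^ n)) UNIV"
    by (intro has_sum_add schur_even has_sum_uminusI has_sum_cmult_right schur_shifted)
  also have "1 + - (q ^ (n + 1) * q ^ n) = 1 - q ^ (2 * n + 1)"
    by (simp add: power_add mult_2)
  finally have f: "(?f has_sum 1 - q ^ (2 * n + 1)) UNIV" .
  show ?thesis
  proof (rule has_sum_add_reindex_diff[OF f, where \<sigma> = "\<lambda>j. - j"])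
    let ?v = "\<lambda>j::int. q powi (6 * j\<^sup>2 + 2 * j + n + 1) * qbin q (2 * n) (int n - 1 - 3 * j)"
    show "?v summable_on UNIV"
      by (rule summable_on_qbin)
    fix j :: int
    have b: "qbin q (2 * n + 1) (int n + 3 * j) = qbin q (2 * n) (int n - 3 * j)
        + q powi (int n + 1 - 3 * j) * qbin q (2 * n) (int n - 1 - 3 * - j)"
      "qbin q (2 * n + 1) (int n - 3 * j) = qbin q (2 * n) (int n - 3 * j - 1)
        + q powi (int n - 3 * j) * qbin q (2 * n) (int n - 3 * j)"
      using qbin_Suc[of "2 * n" "int n + 3 * j"] qbin_Suc'[of "2 * n" "int n - 3 * j"]
        qbin_sym[of q "2 * n" "int n - 3 * j"]
      by (simp_all add: algebra_simps)
    have p: "q powi (6 * j\<^sup>2 + j) * q powi (int n + 1 - 3 * j) = q powi (6 * (-j)\<^sup>2 + 2 * (-j) + n + 1)"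
      "q powi (6 * j\<^sup>2 + 5 * j + 1) * q powi (int n - 3 * j) = q powi int (n + 1) * q powi (6 * j\<^sup>2 + 2 * j)"
      "q powi (6 * j\<^sup>2 + 2 * j + n + 1) = q powi int (n + 1) * q powi (6 * j\<^sup>2 + 2 * j)"
      unfolding powi_mult by (simp_all add: algebra_simps)
    have "?T j = q powi (6 * j\<^sup>2 + j) * qbin q (2 * n) (int n - 3 * j)
        + (q powi (6 * j\<^sup>2 + j) * q powi (int n + 1 - 3 * j)) * qbin q (2 * n) (int n - 1 - 3 * - j)
        - (q powi (6 * j\<^sup>2 + 5 * j + 1) * qbin q (2 * n) (int n - 3 * j - 1)
          + (q powi (6 * j\<^sup>2 + 5 * j + 1) * q powi (int n - 3 * j)) * qbin q (2 * n) (int n - 3 * j))"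
      unfolding b by (simp add: algebra_simps)
    also have "\<dots> = ?f j + ?v (- j) - ?v j"
      unfolding p power_int_of_nat by (simp add: algebra_simps)
    finally show "?T j = ?f j + ?v (- j) - ?v j" .
  qed simp
qed

section \<open>Summing the kernel: Durfee rectangles and Bailey's lemma\<close>

lemma rqfac_bounded:
  obtains C where "C > 0" "\<And>k. norm (rqfac q k) \<le> C"
proof -
  have "q * q ^ k \<noteq> 1" for k
    using power_neq_1[of "Suc k"] by simp
  then obtain C where "C > 0" "\<And>n. norm (1 / qfac q q n) \<le> C"
    using inverse_qfac_bounded[OF q1, of q] by blast
  then show ?thesis
    using that[of C] by (auto simp: rqfac_def less_imp_le)
qed

lemma qfac_inf_self_neq_0: "qfac_inf q q \<noteq> 0"
  using power_neq_1[of "Suc _"] by (intro qfac_inf_neq_0 q1) simp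

text \<open>The difference D(c) of the sums for c and c + 1 satisfies D(c) = - q^(c+1) D(c+1), so a bounded D vanishes;
  the common value is read off as c tends to infinity.\<close>

lemma durfee_rectangle:
  "((\<lambda>m. q ^ (m\<^sup>2 + c * m) / (qfac q q m * qfac q q (m + c))) has_sum 1 / qfac_inf q q) UNIV"
proof -
  define t where "t c m = q ^ (m\<^sup>2 + c * m) / (qfac q q m * qfac q q (m + c))" for c m
  define F where "F c = infsum (t c) UNIV" for c
  obtain C where C: "C > 0" "\<And>n. norm (rqfac q n) \<le> C"
    using rqfac_bounded by blast
  define w where "w m = C * C * norm q ^ m" for m :: nat
  have w: "w summable_on UNIV"
    unfolding w_def using q1
    by (intro summable_on_cmult_right norm_summable_imp_summable_on) simp
  \<comment> \<open>The majorant is independent of \<open>c\<close>; it serves summability, the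
    uniform bound on \<open>F\<close> and the limit in \<open>c\<close>.\<close>
  have tw: "norm (t c m) \<le> w m" for c m
  proof -
    have "m \<le> m\<^sup>2 + c * m"
      by (simp add: power2_eq_square trans_le_add1)
    then have "norm q ^ (m\<^sup>2 + c * m) \<le> norm q ^ m"
      using q1 by (intro power_decreasing) auto
    then have "norm (rqfac q (int m)) * norm (rqfac q (int (m + c))) * norm q ^ (m\<^sup>2 + c * m) \<le> w m"
      unfolding w_def using C(1) by (intro mult_mono C) auto
    moreover have "t c m = rqfac q (int m) * rqfac q (int (m + c)) * q ^ (m\<^sup>2 + c * m)"
      unfolding t_def rqfac_of_nat by simp
    ultimately show ?thesis
      by (simp only: norm_mult norm_power)
  qed
  have "(\<lambda>m. norm (t c m)) summable_on UNIV" for c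
    using w tw[of c] by (rule summable_on_comparison_test) auto
  then have t: "(t c has_sum F c) UNIV" for c
    unfolding F_def by (rule has_sum_infsum[OF abs_summable_summable])
  note ts = has_sum_imp_sums[OF t]
  have FK: "norm (F c) \<le> infsum w UNIV" for c
    using t has_sum_infsum[OF w] tw by (rule norm_infsum_le)
  have rec: "F c - F (c + 1) = - (q ^ (c + 1)) * (F (c + 1) - F (c + 2))" for c
  proof -
    \<comment> \<open>The last term completes the difference to a multiple of 1 - q^m. This factor
      kills the term m = 0 and cancels the last factor of (q;q)_m otherwise, so a shift of m
      produces \<open>t (c + 2)\<close>.\<close>
    let ?g = "\<lambda>m. t c m - t (c + 1) m + q ^ (c + 1) * t (c + 1) m"
    have g: "?g m = (1 - q ^ m) * q ^ (m\<^sup>2 + c * m) / (qfac q q m * qfac q q (m + c + 1))" for m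
    proof -
      have "t c m = (1 - q ^ (m + c + 1)) * q ^ (m\<^sup>2 + c * m) / (qfac q q m * qfac q q (m + c + 1))"
        using qfac_neq_0[of "Suc (m + c)"] qfac_neq_0[of m]
        by (simp add: t_def qfac_Suc field_simps)
      moreover have "t (c + 1) m = q ^ m * q ^ (m\<^sup>2 + c * m) / (qfac q q m * qfac q q (m + c + 1))"
        by (simp add: t_def power_add[symmetric] algebra_simps)
      ultimately show ?thesis
        by (simp add: diff_divide_distrib[symmetric] add_divide_distrib[symmetric] power_add algebra_simps)
    qed
    have "?g (Suc m) = q ^ (c + 1) * t (c + 2) m" for m
    proof -
      have "q ^ ((Suc m)\<^sup>2 + c * Suc m) = q ^ (c + 1) * q ^ (m\<^sup>2 + (c + 2) * m)"
        by (simp add: power_add[symmetric] power2_eq_square algebra_simps)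
      then show ?thesis
        unfolding g using qfac_neq_0[of "Suc m"]
        by (simp add: t_def qfac_Suc[of q q m] add_ac)
    qed
    moreover have "?g 0 = 0"
      unfolding g by simp
    ultimately have "?g sums (q ^ (c + 1) * F (c + 2))"
      using sums_Suc_iff[of ?g "q ^ (c + 1) * F (c + 2)"] sums_mult[OF ts[of "c + 2"], of "q ^ (c + 1)"] by simp
    moreover have "?g sums (F c - F (c + 1) + q ^ (c + 1) * F (c + 1))"
      by (intro sums_add sums_diff sums_mult ts)
    ultimately have "F c - F (c + 1) + q ^ (c + 1) * F (c + 1) = q ^ (c + 1) * F (c + 2)"
      by (rule sums_unique2[symmetric])
    then show ?thesis
      by (simp add: algebra_simps)
  qed
  have dec: "norm (F c - F (c + 1)) \<le> norm q ^ k * (2 * infsum w UNIV)" for c k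
  proof (induction k arbitrary: c)
    case 0
    show ?case
      using norm_triangle_ineq4[of "F c" "F (c + 1)"] FK[of c] FK[of "c + 1"] by simp
  next
    case (Suc k)
    have "norm (F c - F (c + 1)) = norm q ^ (c + 1) * norm (F (c + 1) - F (c + 1 + 1))"
      unfolding rec[of c] by (simp add: norm_mult norm_power)
    also have "\<dots> \<le> norm q * (norm q ^ k * (2 * infsum w UNIV))"
      using q1 Suc.IH[of "c + 1"] power_decreasing[of 1 "c + 1" "norm q"] by (intro mult_mono) auto
    finally show ?case
      by simp
  qed
  have "F c = F (c + 1)" for c
  proof -
    have "(\<lambda>k. norm q ^ k * (2 * infsum w UNIV)) \<longlonglongrightarrow> 0"
      using q1 by (intro tendsto_mult_left_zero LIMSEQ_power_zero) simp
    then have "norm (F c - F (c + 1)) \<le> 0"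
      using dec[of c] by (intro LIMSEQ_le_const) auto
    then show ?thesis
      by simp
  qed
  then have const: "F c = F 0" for c
    by (induction c) auto
  \<comment> \<open>For m > 0 the factor q^(c m) tends to 0, so only the term m = 0
    survives.\<close>
  have lim: "(\<lambda>c. t c m) \<longlonglongrightarrow> (if m = 0 then 1 / qfac_inf q q else 0)" for m
  proof (cases "m = 0")
    case True
    then show ?thesis
      unfolding t_def using qfac_inf_self_neq_0 by (auto intro!: tendsto_divide qfac_tendsto q1)
  next
    case False
    have "(\<lambda>c. q ^ (m\<^sup>2) * (q ^ m) ^ c / (qfac q q m * qfac q q (c + m))) \<longlonglongrightarrow>
        q ^ (m\<^sup>2) * 0 / (qfac q q m * qfac_inf q q)"
      using False q1 qfac_inf_self_neq_0 qfac_neq_0[of m] LIMSEQ_ignore_initial_segment[OF qfac_tendsto[OF q1]]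
      by (intro tendsto_intros LIMSEQ_power_zero) (auto simp: norm_power power_less_one_iff)
    then show ?thesis
      using False by (simp add: t_def power_add power_mult[symmetric] mult.commute add.commute)
  qed
  have "(\<lambda>c. F c) \<longlonglongrightarrow> infsum (\<lambda>m::nat. if m = 0 then 1 / qfac_inf q q else 0) UNIV"
    unfolding F_def using infsum_dominated_convergence(2)[OF w tw lim] .
  moreover have "infsum (\<lambda>m::nat. if m = 0 then 1 / qfac_inf q q else 0) UNIV = 1 / qfac_inf q q"
    by (intro infsumI has_sum_finite_neutralI[where B = "{0}"]) auto
  moreover have "(\<lambda>c. F c) \<longlonglongrightarrow> F 0"
    by (subst const) (rule tendsto_const)
  ultimately have "F 0 = 1 / qfac_inf q q"
    by (metis LIMSEQ_unique)
  then show ?thesis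
    using t[of c] const[of c] by (simp add: t_def[abs_def])
qed

text \<open>For k = K >= 0 the terms n < K vanish, and n = m + K gives the Durfee rectangle with c =
  2 K + 1. Negative k follow from the symmetry k to -1 - k, which swaps the two reciprocals and
  preserves k^2 + k.\<close>

lemma bailey_sum_int:
  "(\<lambda>n. q ^ (n\<^sup>2 + n) * rqfac q (int n - k) * rqfac q (int n + k + 1)) sums (q powi (k\<^sup>2 + k) / qfac_inf q q)"
proof -
  have nonneg: "(\<lambda>n. q ^ (n\<^sup>2 + n) * rqfac q (int n - int K) * rqfac q (int n + int K + 1)) sums
      (q powi ((int K)\<^sup>2 + int K) / qfac_inf q q)" (is "?f sums _") for K
  proof (subst sums_zero_iff_shift[symmetric, where n = K])
    have "?f (m + K) = q ^ (K\<^sup>2 + K) * (q ^ (m\<^sup>2 + (2 * K + 1) * m) / (qfac q q m * qfac q q (m + (2 * K + 1))))" for m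
    proof -
      have "(m + K)\<^sup>2 + (m + K) = (K\<^sup>2 + K) + (m\<^sup>2 + (2 * K + 1) * m)"
        by (simp add: power2_eq_square algebra_simps)
      moreover have "int (m + K) + int K + 1 = int (m + (2 * K + 1))" "int (m + K) - int K = int m"
        by simp_all
      ultimately show ?thesis
        by (simp only: power_add rqfac_of_nat) simp
    qed
    moreover have "q powi ((int K)\<^sup>2 + int K) = q ^ (K\<^sup>2 + K)"
      by (metis of_nat_add of_nat_power power_int_of_nat)
    ultimately show "(\<lambda>m. ?f (m + K)) sums (q powi ((int K)\<^sup>2 + int K) / qfac_inf q q)"
      using sums_mult[OF has_sum_imp_sums[OF durfee_rectangle[of "2 * K + 1"]], of "q ^ (K\<^sup>2 + K)"] by simp
  qed simp
  show ?thesis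
  proof (cases "k \<ge> 0")
    case True
    then show ?thesis
      using nonneg[of "nat k"] by simp
  next
    case False
    then have "k = - 1 - int (nat (- 1 - k))"
      by simp
    then obtain K where K: "k = - 1 - int K" ..
    show ?thesis
      using nonneg[of K] unfolding K by (simp add: power2_eq_square algebra_simps)
  qed
qed

text \<open>An exchange of the sums over n and j. The bound on \<open>e\<close> gives a geometric
  majorant in j, the weight q^(n^2+n) one in n, and the reciprocals are bounded. Since k^2 + k >= 0
  at every integer, the index function \<open>k\<close> may be arbitrary.\<close>

lemma bailey_sum:
  fixes e k :: "int \<Rightarrow> int"
  assumes e: "\<And>j. \<bar>j\<bar> \<le> e j"
  defines "s \<equiv> \<lambda>n j. q powi e j * rqfac q (int n - k j) * rqfac q (int n + k j + 1)"
  shows "s n summable_on UNIV"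
    and "(\<lambda>j. q powi (e j + (k j)\<^sup>2 + k j)) summable_on UNIV"
    and "(\<lambda>n. q ^ (n\<^sup>2 + n) * infsum (s n) UNIV) sums
           ((\<Sum>\<^sub>\<infinity>j. q powi (e j + (k j)\<^sup>2 + k j)) / qfac_inf q q)"
proof -
  obtain C where C: "C > 0" "\<And>n. norm (rqfac q n) \<le> C"
    using rqfac_bounded by blast
  define r where "r j = norm q ^ nat \<bar>j\<bar>" for j :: int
  have r: "r summable_on UNIV"
    unfolding r_def using q1 by (intro summable_on_power_abs_int) auto
  have er: "norm (q powi e j) \<le> r j" for j
  proof -
    have "norm q ^ nat (e j) \<le> norm q ^ nat \<bar>j\<bar>"
      using e[of j] q1 by (intro power_decreasing) auto
    moreover have "0 \<le> e j"
      using e[of j] by linarith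
    ultimately show ?thesis
      by (simp add: r_def power_int_nonneg_exp norm_power)
  qed
  have sr: "norm (s n j) \<le> C * C * r j" for n j
  proof -
    have "norm (s n j) \<le> r j * C * C"
      unfolding s_def norm_mult using er[of j] C by (intro mult_mono) (auto simp: r_def)
    then show ?thesis
      by (simp add: mult_ac)
  qed
  have Cr: "(\<lambda>j. C * C * r j) summable_on UNIV"
    using r by (rule summable_on_cmult_right)
  have sn: "(\<lambda>j. norm (s n j)) summable_on UNIV" for n
    using Cr sr by (rule summable_on_comparison_test) auto
  then show ssum: "s n summable_on UNIV" for n
    by (rule abs_summable_summable)
  have "norm (q powi (e j + (k j)\<^sup>2 + k j)) \<le> r j" for j
  proof -
    have "0 \<le> (k j)\<^sup>2 + k j"
      using zero_le_mult_iff[of "k j" "k j + 1"] by (simp add: power2_eq_square algebra_simps) linarith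
    then have "norm (q powi (k j ^ 2 + k j)) \<le> 1"
      using q1 by (simp add: power_int_nonneg_exp norm_power power_le_one)
    then have "norm (q powi e j) * norm (q powi (k j ^ 2 + k j)) \<le> r j * 1"
      using er[of j] by (intro mult_mono) (auto simp: r_def)
    then show ?thesis
      by (simp add: norm_mult[symmetric] powi_mult add.assoc)
  qed
  then have "(\<lambda>j. norm (q powi (e j + (k j)\<^sup>2 + k j))) summable_on UNIV"
    by (intro summable_on_comparison_test[OF r]) auto
  then show rhs: "(\<lambda>j. q powi (e j + (k j)\<^sup>2 + k j)) summable_on UNIV"
    by (rule abs_summable_summable)
  define f where "f n j = q ^ (n\<^sup>2 + n) * s n j" for n j
  have fr: "norm (f n j) \<le> norm q ^ n * (C * C * r j)" for n j
  proof -
    have "norm q ^ (n\<^sup>2 + n) \<le> norm q ^ n"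
      using q1 by (intro power_decreasing) auto
    then show ?thesis
      unfolding f_def norm_mult norm_power using sr[of n j] by (intro mult_mono) auto
  qed
  have "(\<lambda>(n, j). norm q ^ n * (C * C * r j)) summable_on UNIV \<times> UNIV"
  proof (rule summable_on_SigmaI)
    fix n :: nat
    show "((\<lambda>j. case (n, j) of (n, j) \<Rightarrow> norm q ^ n * (C * C * r j)) has_sum
        norm q ^ n * infsum (\<lambda>j. C * C * r j) UNIV) UNIV"
      using has_sum_cmult_right[OF has_sum_infsum[OF Cr], of "norm q ^ n"] by simp
  next
    show "(\<lambda>n. norm q ^ n * infsum (\<lambda>j. C * C * r j) UNIV) summable_on UNIV"
      using q1 by (intro summable_on_cmult_left norm_summable_imp_summable_on) simp
  qed (use C in \<open>auto simp: r_def\<close>)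
  then have "(\<lambda>x. norm (case x of (n, j) \<Rightarrow> f n j)) summable_on UNIV \<times> UNIV"
    by (rule summable_on_comparison_test) (use fr in auto)
  then have fsum: "(\<lambda>(n, j). f n j) summable_on UNIV \<times> UNIV"
    by (rule abs_summable_summable)
  have inner: "infsum (\<lambda>n. f n j) UNIV = q powi (e j + (k j)\<^sup>2 + k j) / qfac_inf q q" for j
  proof -
    have "summable (\<lambda>n. norm (f n j))"
      using q1 by (intro summable_comparison_test[OF _ summable_mult2[OF summable_geometric[of "norm q"]]])
        (use fr in auto)
    moreover have "(\<lambda>n. q powi e j * (q ^ (n\<^sup>2 + n) * rqfac q (int n - k j) * rqfac q (int n + k j + 1))) sums
        (q powi e j * (q powi ((k j)\<^sup>2 + k j) / qfac_inf q q))"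
      by (intro sums_mult bailey_sum_int)
    then have "(\<lambda>n. f n j) sums (q powi (e j + (k j)\<^sup>2 + k j) / qfac_inf q q)"
      by (simp add: f_def s_def powi_mult mult_ac add.assoc)
    ultimately show ?thesis
      by (intro infsumI norm_summable_imp_has_sum)
  qed
  have "(\<lambda>n. infsum (f n) UNIV) summable_on UNIV"
    using summable_on_Sigma_banach[of f UNIV "\<lambda>_. UNIV"] fsum by simp
  then have "(\<lambda>n. infsum (f n) UNIV) sums infsum (\<lambda>n. infsum (f n) UNIV) UNIV"
    by (intro has_sum_imp_sums has_sum_infsum)
  also have "infsum (\<lambda>n. infsum (f n) UNIV) UNIV = infsum (\<lambda>j. infsum (\<lambda>n. f n j) UNIV) UNIV"
    using fsum by (rule infsum_swap_banach)
  also have "\<dots> = (\<Sum>\<^sub>\<infinity>j. q powi (e j + (k j)\<^sup>2 + k j)) / qfac_inf q q"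
    unfolding inner using infsum_cmult_left[of "1 / qfac_inf q q", OF rhs] by simp
  finally show "(\<lambda>n. q ^ (n\<^sup>2 + n) * infsum (s n) UNIV) sums
           ((\<Sum>\<^sub>\<infinity>j. q powi (e j + (k j)\<^sup>2 + k j)) / qfac_inf q q)"
    unfolding f_def using infsum_cmult_right[OF ssum] by simp
qed

section \<open>Both series at m = 0 as theta series\<close>

lemma abs_le_exponents:
  fixes j :: int
  shows "\<bar>j\<bar> \<le> 6 * j\<^sup>2 + j" "\<bar>j\<bar> \<le> 6 * j\<^sup>2 + 5 * j + 1"
proof -
  have "\<bar>j\<bar> \<le> j\<^sup>2"
    using abs_le_square_iff[of 1 j] self_le_power[of "\<bar>j\<bar>" 2] by (cases "j = 0") auto
  then show "\<bar>j\<bar> \<le> 6 * j\<^sup>2 + j" "\<bar>j\<bar> \<le> 6 * j\<^sup>2 + 5 * j + 1"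
    by linarith+
qed

text \<open>Divided by (q;q)_{2n+1}, each binomial of the odd row becomes the kernel, because (2 n +
  1) - (n - r) = n + r + 1. The applications have \<open>\<beta>\<close> equal to 1 and to 1 -
  q^(2n+1).\<close>

lemma bailey_difference:
  fixes e e' k k' :: "int \<Rightarrow> int"
  assumes "\<And>j. \<bar>j\<bar> \<le> e j" "\<And>j. \<bar>j\<bar> \<le> e' j"
    and "\<And>n. ((\<lambda>j. q powi e j * qbin q (2 * n + 1) (int n - k j)
                - q powi e' j * qbin q (2 * n + 1) (int n - k' j)) has_sum \<beta> n) UNIV"
  shows "(\<lambda>n. q ^ (n\<^sup>2 + n) * \<beta> n / qfac q q (2 * n + 1)) sums
    ((\<Sum>\<^sub>\<infinity>j. q powi (e j + (k j)\<^sup>2 + k j) - q powi (e' j + (k' j)\<^sup>2 + k' j)) / qfac_inf q q)"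
proof -
  let ?s = "\<lambda>e k n j. q powi e j * rqfac q (int n - k j) * rqfac q (int n + k j + 1)"
  have \<beta>: "infsum (?s e k n) UNIV - infsum (?s e' k' n) UNIV = \<beta> n / qfac q q (2 * n + 1)" for n
  proof -
    have "((\<lambda>j. 1 / qfac q q (2 * n + 1) * (q powi e j * qbin q (2 * n + 1) (int n - k j)
        - q powi e' j * qbin q (2 * n + 1) (int n - k' j))) has_sum 1 / qfac q q (2 * n + 1) * \<beta> n) UNIV"
      by (intro has_sum_cmult_right assms(3))
    moreover have "1 / qfac q q (2 * n + 1) * (q powi e j * qbin q (2 * n + 1) (int n - k j)
        - q powi e' j * qbin q (2 * n + 1) (int n - k' j)) = ?s e k n j + - ?s e' k' n j" for j
    proof -
      have "int (2 * n + 1) - (int n - i) = int n + i + 1" for i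
        by simp
      then show ?thesis
        using qfac_neq_0[of "2 * n + 1"] unfolding qbin_def by (simp add: field_simps)
    qed
    ultimately have "((\<lambda>j. ?s e k n j + - ?s e' k' n j) has_sum \<beta> n / qfac q q (2 * n + 1)) UNIV"
      by simp
    moreover have "((\<lambda>j. ?s e k n j + - ?s e' k' n j) has_sum
        (infsum (?s e k n) UNIV + - infsum (?s e' k' n) UNIV)) UNIV"
      by (intro has_sum_add has_sum_uminusI has_sum_infsum bailey_sum(1) assms)
    ultimately show ?thesis
      using has_sum_unique by fastforce
  qed
  have "((\<lambda>j. q powi (e j + (k j)\<^sup>2 + k j) + - (q powi (e' j + (k' j)\<^sup>2 + k' j))) has_sum
        ((\<Sum>\<^sub>\<infinity>j. q powi (e j + (k j)\<^sup>2 + k j)) + - (\<Sum>\<^sub>\<infinity>j. q powi (e' j + (k' j)\<^sup>2 + k' j)))) UNIV"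
    by (intro has_sum_add has_sum_uminusI has_sum_infsum bailey_sum(2) assms)
  then have "(\<Sum>\<^sub>\<infinity>j. q powi (e j + (k j)\<^sup>2 + k j) - q powi (e' j + (k' j)\<^sup>2 + k' j)) =
      (\<Sum>\<^sub>\<infinity>j. q powi (e j + (k j)\<^sup>2 + k j)) - (\<Sum>\<^sub>\<infinity>j. q powi (e' j + (k' j)\<^sup>2 + k' j))"
    by (simp add: infsumI)
  then show ?thesis
    using sums_diff[OF bailey_sum(3)[of e k] bailey_sum(3)[of e' k']] assms(1,2) \<beta>
    by (simp add: right_diff_distrib[symmetric] diff_divide_distrib)
qed

lemma sum_odd_theta:
  "(\<lambda>n. q ^ (n\<^sup>2 + n) / qfac q q (2 * n + 1)) sums
    ((\<Sum>\<^sub>\<infinity>j. q powi (15 * j\<^sup>2 + 4 * j) - q powi (15 * j\<^sup>2 + 14 * j + 3)) / qfac_inf q q)"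
proof -
  have e: "6 * j\<^sup>2 + j + (3 * j)\<^sup>2 + 3 * j = 15 * j\<^sup>2 + 4 * j"
    "6 * j\<^sup>2 + 5 * j + 1 + (3 * j + 1)\<^sup>2 + (3 * j + 1) = 15 * j\<^sup>2 + 14 * j + 3" for j :: int
    by (simp_all add: power2_eq_square algebra_simps)
  show ?thesis
    using bailey_difference[where k = "\<lambda>j. 3 * j" and k' = "\<lambda>j. 3 * j + 1" and \<beta> = "\<lambda>_. 1",
        OF abs_le_exponents] schur_odd unfolding e by (simp add: diff_diff_eq)
qed

text \<open>The binomials of \<open>schur_odd'\<close> stand at n + 3 j and n - 3 j, hence the
  indices -3 j and 3 j; its value 1 - q^(2n+1) lowers the denominator to (q;q)_{2n}.\<close>

lemma sum_even_theta:
  "(\<lambda>n. q ^ (n\<^sup>2 + n) / qfac q q (2 * n)) sums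
    ((\<Sum>\<^sub>\<infinity>j. q powi (15 * j\<^sup>2 - 2 * j) - q powi (15 * j\<^sup>2 + 8 * j + 1)) / qfac_inf q q)"
proof -
  have e: "6 * j\<^sup>2 + j + (- 3 * j)\<^sup>2 + - 3 * j = 15 * j\<^sup>2 - 2 * j"
    "6 * j\<^sup>2 + 5 * j + 1 + (3 * j)\<^sup>2 + 3 * j = 15 * j\<^sup>2 + 8 * j + 1" for j :: int
    by (simp_all add: power2_eq_square algebra_simps)
  have "q ^ (n\<^sup>2 + n) * (1 - q ^ (2 * n + 1)) / qfac q q (2 * n + 1) = q ^ (n\<^sup>2 + n) / qfac q q (2 * n)" for n
    using qfac_neq_0[of "Suc (2 * n)"] by (simp add: qfac_Suc)
  then show ?thesis
    using bailey_difference[where k = "\<lambda>j. - 3 * j" and k' = "\<lambda>j. 3 * j" and \<beta> = "\<lambda>n. 1 - q ^ (2 * n + 1)",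
        OF abs_le_exponents] schur_odd' unfolding e by (simp add: left_diff_distrib)
qed

end

section \<open>The quintuple product identity\<close>

text \<open>Raising n changes each summand by a difference in k, so the sum does not depend on n; at
  n = 0 it is (1 + x)(1 - x)/(1 - x^2) = 1.\<close>

lemma quintuple_product_finite:
  fixes x p :: complex
  assumes p: "p \<noteq> 0" "norm p < 1" and x: "\<And>i. x\<^sup>2 * p ^ i \<noteq> 1"
  shows "(\<Sum>k\<le>n. (1 + x * p ^ k) * qbin p n (int k) * x ^ k * p ^ (k\<^sup>2) / qfac (x\<^sup>2 * p ^ k) p (Suc n))
    * qfac x p (Suc n) = 1"
proof -
  define D where "D n k = qfac (x\<^sup>2 * p ^ k) p (Suc n)" for n k
  define t where "t n k = qfac x p (Suc n) * ((1 + x * p ^ k) * qbin p n (int k) * x ^ k * p ^ (k\<^sup>2) / D n k)" for n k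
  \<comment> \<open>Wilf-Zeilberger mate of the summand\<close>
  define G where "G n k = - (qfac x p (Suc n) * x ^ k * p ^ (n + 1 + k * (k - 1)) * qbin p n (int k - 1) / D n k)" for n k
  have D0: "D n k \<noteq> 0" for n k
    unfolding D_def qfac_def using x by (auto simp: mult.assoc power_add[symmetric])
  have step: "t (Suc n) k - t n k = G n (Suc k) - G n k" if "k \<le> Suc n" for n k
  proof -
    \<comment> \<open>Since p^(n+1) = M K, the mate equation divided by
      \<open>X * u * y / D (Suc n) k\<close> is a polynomial identity in x, K and M.\<close>
    define K M where "K = p ^ k" and "M = p ^ (Suc n - k)"
    define X where "X = qfac x p (Suc n)"
    define y where "y = x ^ k * p ^ (k\<^sup>2)"
    \<comment> \<open>Common factor of all three binomials; the index n + 1 - k, in place of n - k,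
      covers the ends k = 0 and k = n + 1 without case distinctions.\<close>
    define u where "u = qfac p p n * rqfac p (int k) * rqfac p (int n + 1 - int k)"
    have N: "p ^ Suc n = M * K"
      using that unfolding M_def K_def by (metis le_add_diff_inverse2 power_add)
    have 1: "D (Suc n) k = D n k * (1 - x\<^sup>2 * K * (M * K))"
      unfolding D_def qfac_Suc[of "x\<^sup>2 * p ^ k" p "Suc n"] N by (simp add: K_def)
    have 2: "D (Suc n) k = D n (Suc k) * (1 - x\<^sup>2 * K)"
      unfolding D_def qfac_Suc_shift[of "x\<^sup>2 * p ^ k" p "Suc n"] by (simp add: K_def mult_ac)
    have M': "p powi (int n + 1 - int k) = M"
      using that unfolding M_def by (metis of_nat_Suc of_nat_diff power_int_of_nat add.commute)
    have b1: "qbin p n (int k - 1) = (1 - K) * u"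
      using rqfac_pred[OF p, of "int k"] by (simp add: qbin_def u_def K_def algebra_simps)
    have b2: "qbin p n (int k) = (1 - M) * u"
      using rqfac_pred[OF p, of "int n + 1 - int k"] unfolding M' by (simp add: qbin_def u_def)
    have b3: "qbin p (Suc n) (int k) = (1 - M * K) * u"
    proof -
      have "int (Suc n) - int k = int n + 1 - int k" "p * p ^ n = M * K"
        using N by simp_all
      then show ?thesis
        unfolding qbin_def qfac_Suc u_def by (simp only: mult_ac)
    qed
    have e1: "p ^ (n + 1 + Suc k * (Suc k - 1)) * x ^ Suc k = y * x * (M * K * K)"
      unfolding N[symmetric] by (simp add: y_def K_def power_add[symmetric] power2_eq_square mult_ac add_ac)
    have "n + 1 + k * (k - 1) = k\<^sup>2 + (Suc n - k)"
      using that by (cases k) (auto simp: power2_eq_square)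
    then have e2: "p ^ (n + 1 + k * (k - 1)) * x ^ k = y * M"
      by (simp add: y_def M_def power_add)
    have X': "qfac x p (Suc (Suc n)) = X * (1 - x * (M * K))"
      unfolding X_def qfac_Suc[of x p "Suc n"] N ..
    have i1: "1 / D n k = (1 - x\<^sup>2 * K * (M * K)) / D (Suc n) k"
      using D0[of "Suc n" k] D0[of n k] unfolding 1 by simp
    have i2: "1 / D n (Suc k) = (1 - x\<^sup>2 * K) / D (Suc n) k"
      using D0[of "Suc n" k] D0[of n "Suc k"] unfolding 2 by simp
    have "t (Suc n) k - t n k = X * (1 - x * (M * K)) * ((1 + x * K) * ((1 - M * K) * u) * y * (1 / D (Suc n) k))
        - X * ((1 + x * K) * ((1 - M) * u) * y * (1 / D n k))"
      unfolding t_def b2 b3 X' X_def[symmetric] K_def[symmetric] by (simp add: y_def mult_ac)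
    also have "\<dots> = X * u * y * ((1 - x * (M * K)) * (1 + x * K) * (1 - M * K)
        - (1 + x * K) * (1 - M) * (1 - x\<^sup>2 * K * (M * K))) / D (Suc n) k"
      unfolding i1 by (simp add: algebra_simps diff_divide_distrib add_divide_distrib)
    also have "(1 - x * (M * K)) * (1 + x * K) * (1 - M * K)
        - (1 + x * K) * (1 - M) * (1 - x\<^sup>2 * K * (M * K))
      = M * (1 - K) * (1 - x\<^sup>2 * K * (M * K)) - x * (M * K * K) * (1 - M) * (1 - x\<^sup>2 * K)"
      by (simp add: algebra_simps power2_eq_square)
    also have "X * u * y * \<dots> / D (Suc n) k = - (X * (y * x * (M * K * K)) * ((1 - M) * u) * (1 / D n (Suc k)))
        + X * (y * M) * ((1 - K) * u) * (1 / D n k)"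
      unfolding i1 i2 by (simp add: algebra_simps diff_divide_distrib add_divide_distrib)
    also have "\<dots> = G n (Suc k) - G n k"
      unfolding G_def e1[symmetric] e2[symmetric] b1 X_def[symmetric]
      using b2 by (simp add: mult_ac)
    finally show ?thesis .
  qed
  have "(\<Sum>k\<le>n. t n k) = 1"
  proof (induction n)
    case 0
    have "1 - x\<^sup>2 \<noteq> 0"
      using x[of 0] by simp
    moreover have "(1 + x) * (1 - x) = 1 - x\<^sup>2"
      by (simp add: power2_eq_square algebra_simps)
    ultimately show ?case
      by (simp add: t_def D_def qfac_Suc mult_ac)
  next
    case (Suc n)
    \<comment> \<open>Both sums run to n + 1, where \<open>t n\<close> is 0. The telescoped ends
      \<open>G n 0\<close> and \<open>G n (n + 2)\<close> vanish because their binomials have lower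
      index -1 and n + 1.\<close>
    have "(\<Sum>k\<le>Suc n. t (Suc n) k) - (\<Sum>k\<le>Suc n. t n k) = - (\<Sum>k\<le>Suc n. G n k - G n (Suc k))"
      unfolding sum_subtractf[symmetric] sum_negf[symmetric] using step by (intro sum.cong) auto
    also have "\<dots> = G n (Suc (Suc n)) - G n 0"
      unfolding sum_telescope by simp
    also have "\<dots> = 0"
      by (simp add: G_def qbin_eq_0)
    also have "(\<Sum>k\<le>Suc n. t n k) = (\<Sum>k\<le>n. t n k)"
      by (simp add: t_def qbin_eq_0)
    finally show ?case
      using Suc.IH by simp
  qed
  then show ?thesis
    unfolding t_def D_def sum_distrib_left[symmetric] by (simp add: mult.commute)
qed

section \<open>Recentring the finite identity and passing to the limit\<close>

lemma qfac_add: "qfac a p (m + n) = qfac a p m * qfac (a * p ^ m) p n"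
  by (induction n) (simp_all add: qfac_Suc power_add mult_ac)

lemma triangular_Suc: "int (Suc c) * (int (Suc c) + 1) div 2 = int c * (int c + 1) div 2 + (int c + 1)"
proof -
  have "int (Suc c) * (int (Suc c) + 1) = int c * (int c + 1) + (int c + 1) * 2"
    by (simp add: algebra_simps)
  then show ?thesis
    by (simp only: div_mult_self1)
qed

text \<open>Factor by factor, 1 - a p^(-i) = -a p^(-i) (1 - p^i / a) for i = 1..c. The extracted
  powers feed the theta exponent, and the remaining product has a limit as c grows.\<close>

lemma qfac_reflect:
  assumes "a \<noteq> 0" "p \<noteq> 0"
  shows "qfac (a * p powi (- int c)) p c =
    (- a) ^ c * p powi (- (int c * (int c + 1) div 2)) * qfac (p / a) p c"
proof (induction c)
  case (Suc c)
  have s: "a * p powi (- int (Suc c)) * p = a * p powi (- int c)"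
    using power_int_add[of p "- int (Suc c)" 1] assms by simp
  have e: "p powi (- (int (Suc c) * (int (Suc c) + 1) div 2)) =
      p powi (- (int c * (int c + 1) div 2)) * inverse (p ^ Suc c)"
    unfolding triangular_Suc using assms
    by (simp add: power_int_minus[symmetric] power_int_add[symmetric] power_int_of_nat[symmetric]
        algebra_simps del: power_Suc power_int_of_nat)
  have f: "1 - a * p powi (- int (Suc c)) = - a * inverse (p ^ Suc c) * (1 - p / a * p ^ c)"
    using assms by (simp only: power_int_minus power_int_of_nat) (simp add: field_simps)
  show ?case
    unfolding qfac_Suc_shift[of "a * p powi (- int (Suc c))" p c] s Suc.IH qfac_Suc[of "p / a"] e f by (simp add: mult_ac)
qed simp

lemma qfac_bilateral:
  assumes "a \<noteq> 0" "p \<noteq> 0"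
  shows "qfac (a * p powi (- int c)) p (c + d) =
    (- a) ^ c * p powi (- (int c * (int c + 1) div 2)) * (qfac a p d * qfac (p / a) p c)"
proof -
  have "a * p powi (- int c) * p ^ c = a"
    using assms by (simp add: power_int_minus)
  then show ?thesis
    by (simp only: qfac_add qfac_reflect[OF assms] mult_ac)
qed

text \<open>The finite identity with 2 m for n and x / p^m for x, recentred at k = m.\<close>

lemma quintuple_product_finite_symmetric:
  fixes x p :: complex
  assumes p: "p \<noteq> 0" "norm p < 1" and x: "x \<noteq> 0" "\<And>i. x\<^sup>2 * p powi i \<noteq> 1"
  shows "((\<lambda>k. (1 + x * p powi k) * (- (x ^ 3)) powi k * p powi (k * (3 * k - 1) div 2) * qbin p (2 * m) (int m + k)
      / (qfac (x\<^sup>2) p (nat (int m + k + 1)) * qfac (p / x\<^sup>2) p (nat (int m - k))))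
    has_sum 1 / (qfac x p (Suc m) * qfac (p / x) p m)) UNIV" (is "(?f has_sum _) _")
proof -
  define y where "y = x * p powi (- int m)"
  have "y\<^sup>2 * p ^ i \<noteq> 1" for i
  proof -
    have "y\<^sup>2 * p ^ i = x\<^sup>2 * p powi (int i - 2 * int m)"
      using p(1) by (simp add: y_def power_int_diff power_int_minus power_mult_distrib power_mult
          power_int_mult field_simps)
    then show ?thesis
      using x(2) by simp
  qed
  from quintuple_product_finite[OF p this, of "2 * m"]
  have fin: "(\<Sum>j\<le>2 * m. (1 + y * p ^ j) * qbin p (2 * m) (int j) * y ^ j * p ^ (j\<^sup>2) / qfac (y\<^sup>2 * p ^ j) p (Suc (2 * m)))
    * qfac y p (Suc (2 * m)) = 1" .
  let ?X = "qfac x p (Suc m) * qfac (p / x) p m"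
  have X: "qfac y p (Suc (2 * m)) = (- x) ^ m * p powi (- (int m * (int m + 1) div 2)) * ?X"
    using qfac_bilateral[OF x(1) p(1), of m "Suc m"] by (simp add: y_def[symmetric] mult_2)
  have term_eq: "(1 + y * p ^ j) * qbin p (2 * m) (int j) * y ^ j * p ^ (j\<^sup>2) / qfac (y\<^sup>2 * p ^ j) p (Suc (2 * m))
      * qfac y p (Suc (2 * m)) = ?f (int j - int m) * ?X" if j: "j \<le> 2 * m" for j
  proof -
    define c where "c = 2 * m - j"
    define k where "k = int j - int m"
    define T where "T n = int n * (int n + 1) div 2" for n
    have c: "int c = int m - k" and j': "int j = int m + k"
      using j by (simp_all add: c_def k_def)
    have "y\<^sup>2 * p ^ j = x\<^sup>2 * p powi (- int c)"
    proof -
      have "p powi (- int c) = p powi (- int m) * p powi (- int m) * p powi (int j)"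
        using p(1) by (simp add: power_int_add[symmetric] c j')
      then show ?thesis
        by (simp add: y_def power2_eq_square mult_ac)
    qed
    moreover have "Suc (2 * m) = c + Suc j"
      using j by (simp add: c_def)
    ultimately have D: "qfac (y\<^sup>2 * p ^ j) p (Suc (2 * m)) =
        (- (x\<^sup>2)) ^ c * p powi (- T c) * (qfac (x\<^sup>2) p (Suc j) * qfac (p / x\<^sup>2) p c)"
      using qfac_bilateral[of "x\<^sup>2" p c "Suc j"] x(1) p(1) by (simp only: T_def) simp
    have T: "2 * T n = int n * (int n + 1)" for n
      unfolding T_def by simp
    \<comment> \<open>Exponents are compared after doubling: each \<open>div 2\<close> is exact by
      parity but opaque to ring arithmetic.\<close>
    have "2 * (k * (3 * k - 1) div 2) = k * (3 * k - 1)"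
      by simp
    then have "2 * (- int m * int j + (int j)\<^sup>2 - T m + T c) = 2 * (k * (3 * k - 1) div 2)"
      using T[of m] T[of c] unfolding c j' by (simp add: algebra_simps power2_eq_square)
    then have e: "- int m * int j + (int j)\<^sup>2 - T m + T c = k * (3 * k - 1) div 2"
      by simp
    \<comment> \<open>Everything extracted by \<open>qfac_bilateral\<close> is collected here; the
      powers of x and of p combine separately, to (-x^3)^k and to the pentagonal power.\<close>
    have "y ^ j * p ^ (j\<^sup>2) * (- x) ^ m * p powi (- T m) / ((- (x\<^sup>2)) ^ c * p powi (- T c)) =
      (x powi int j * (- x) powi int m / (- (x\<^sup>2)) powi int c) *
      (p powi (- int m * int j) * p powi ((int j)\<^sup>2) * p powi (- T m) / p powi (- T c))"
    proof -
      have "p powi ((int j)\<^sup>2) = p ^ (j\<^sup>2)"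
        by (metis of_nat_power power_int_of_nat)
      then show ?thesis
        using power_int_power'[of p "- int m" j]
        by (simp only: y_def power_mult_distrib power_int_of_nat) simp
    qed
    also have "p powi (- int m * int j) * p powi ((int j)\<^sup>2) * p powi (- T m) / p powi (- T c) =
        p powi (k * (3 * k - 1) div 2)"
      unfolding e[symmetric] using p(1) by (simp add: power_int_add power_int_diff power_int_minus field_simps)
    also have "x powi int j * (- x) powi int m / (- (x\<^sup>2)) powi int c = (- (x ^ 3)) powi k"
    proof -
      have a: "(- x) powi int m = (-1) powi int m * x powi int m"
        "(- (x\<^sup>2)) powi int c = (-1) powi int c * x powi (2 * int c)"
        "(- (x ^ 3)) powi k = (-1) powi k * x powi (3 * k)"
        using power_int_mult_distrib[of "-1" x "int m"] power_int_mult_distrib[of "-1" "x\<^sup>2" "int c"]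
          power_int_mult_distrib[of "-1" "x ^ 3" k]
          power_int_power[of x 2 "int c"] power_int_power[of x 3 k] by simp_all
      have k: "k = int m - int c" "3 * k = int j + int m - 2 * int c"
        using c j' by simp_all
      have sgn: "(-1 :: complex) powi k = (-1) powi int m / (-1) powi int c"
        unfolding k(1) by (rule power_int_diff) simp
      show ?thesis
        unfolding a k(2) using x(1) sgn by (simp add: power_int_add power_int_diff)
    qed
    finally have main: "y ^ j * p ^ (j\<^sup>2) * (- x) ^ m * p powi (- T m) / ((- (x\<^sup>2)) ^ c * p powi (- T c)) =
      (- (x ^ 3)) powi k * p powi (k * (3 * k - 1) div 2)" .
    have yp: "y * p ^ j = x * p powi k"
      using p(1) by (simp add: y_def k_def power_int_diff power_int_minus field_simps)
    have n: "nat (int m + k + 1) = Suc j" "nat (int m - k) = c"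
      using c j' by linarith+
    have "(1 + y * p ^ j) * qbin p (2 * m) (int j) * y ^ j * p ^ (j\<^sup>2) / qfac (y\<^sup>2 * p ^ j) p (Suc (2 * m))
      * qfac y p (Suc (2 * m)) = (1 + x * p powi k) * qbin p (2 * m) (int j) *
        (y ^ j * p ^ (j\<^sup>2) * (- x) ^ m * p powi (- T m) / ((- (x\<^sup>2)) ^ c * p powi (- T c)))
        / (qfac (x\<^sup>2) p (Suc j) * qfac (p / x\<^sup>2) p c) * ?X"
      unfolding D X yp T_def[symmetric] by simp
    also have "\<dots> = ?f k * ?X"
      unfolding main n unfolding j'[symmetric] by simp
    finally show ?thesis
      unfolding k_def .
  qed
  have S: "(\<Sum>j\<le>2 * m. ?f (int j - int m)) * ?X = 1"
    by (rule trans[OF _ fin], unfold sum_distrib_right, rule sum.cong[OF refl], rule term_eq[symmetric]) simp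
  have reindex: "(\<Sum>j\<le>2 * m. F (int j - int m)) = (\<Sum>k\<in>{- int m..int m}. F k)" for F :: "int \<Rightarrow> complex"
    by (rule sum.reindex_bij_witness[where i = "\<lambda>k. nat (k + int m)" and j = "\<lambda>j. int j - int m"]) auto
  \<comment> \<open>The product being 1 already shows that \<open>?X\<close> is nonzero.\<close>
  have inv: "s = 1 / X" if "s * X = 1" for s X :: complex
    using that by (metis eq_divide_imp mult_zero_right zero_neq_one)
  have sum: "(\<Sum>k\<in>{- int m..int m}. ?f k) = 1 / ?X"
    using inv[OF S] unfolding reindex[of ?f] .
  \<comment> \<open>Outside the window \<open>nat\<close> may truncate in the denominators, but the
    binomial is 0 there.\<close>
  have zero: "?f k = 0" if "k \<notin> {- int m..int m}" for k
  proof -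
    have "int m + k < 0 \<or> int (2 * m) < int m + k"
      using that by auto
    then show ?thesis
      using qbin_eq_0 by simp
  qed
  show ?thesis
    by (rule has_sum_finite_neutralI[OF _ _ zero sum[symmetric]]) auto
qed

lemma summable_norm_ratio:
  fixes f g :: "nat \<Rightarrow> complex"
  assumes "\<And>n. f (Suc n) = g n * f n" and "g \<longlonglongrightarrow> 0"
  shows "summable (\<lambda>n. norm (f n))"
proof -
  have "eventually (\<lambda>n. norm (g n) < 1 / 2) sequentially"
    using tendsto_norm_zero[OF assms(2)] by (rule order_tendstoD) simp
  then obtain N where N: "\<And>n. n \<ge> N \<Longrightarrow> norm (g n) < 1 / 2"
    by (auto simp: eventually_sequentially)
  show ?thesis
  proof (rule summable_ratio_test[of "1 / 2" N])
    fix n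
    assume "n \<ge> N"
    then show "norm (norm (f (Suc n))) \<le> 1 / 2 * norm (norm (f n))"
      using mult_right_mono[OF less_imp_le[OF N], of n "norm (f n)"] by (simp add: assms(1) norm_mult)
  qed simp
qed

text \<open>Consecutive terms have ratio y p^(3n+1) upwards and y^(-1) p^(3n+2) downwards; both tend
  to 0 whatever the size of y.\<close>

lemma summable_pentagonal_theta:
  fixes y p :: complex
  assumes "y \<noteq> 0" "p \<noteq> 0" "norm p < 1"
  shows "(\<lambda>k. norm (y powi k * p powi (k * (3 * k - 1) div 2))) summable_on UNIV"
proof -
  define h where "h k = y powi k * p powi (k * (3 * k - 1) div 2)" for k
  have lim: "(\<lambda>n. p ^ (3 * n + i)) \<longlonglongrightarrow> 0" for i
  proof -
    have "(\<lambda>n. (p ^ 3) ^ n * p ^ i) \<longlonglongrightarrow> 0"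
      using assms by (intro tendsto_mult_left_zero LIMSEQ_power_zero) (simp add: norm_power power_less_one_iff)
    then show ?thesis
      by (simp add: power_add power_mult)
  qed
  have p_add: "p powi (a + int b) = p powi a * p ^ b" for a b
    using assms by (simp add: power_int_add)
  have "h (int (Suc n)) = y * p ^ (3 * n + 1) * h (int n)" for n
  proof -
    have "int (Suc n) * (3 * int (Suc n) - 1) = int n * (3 * int n - 1) + (int (3 * n + 1)) * 2"
      by (simp add: algebra_simps)
    then have e: "int (Suc n) * (3 * int (Suc n) - 1) div 2 = int n * (3 * int n - 1) div 2 + int (3 * n + 1)"
      by (simp only: div_mult_self1)
    have "y powi int (Suc n) = y * y powi int n"
      by (simp del: of_nat_Suc)
    then show ?thesis
      unfolding h_def e p_add by (simp only: mult_ac)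
  qed
  moreover have "(\<lambda>n. y * p ^ (3 * n + 1)) \<longlonglongrightarrow> 0"
    using lim by (rule tendsto_mult_right_zero)
  ultimately have "summable (\<lambda>n. norm (h (int n)))"
    by (rule summable_norm_ratio)
  then have 1: "(\<lambda>n. norm (h (int n))) summable_on UNIV"
    by (intro norm_summable_imp_summable_on) simp
  have "h (- int (Suc n)) = inverse y * p ^ (3 * n + 2) * h (- int n)" for n
  proof -
    have "- int (Suc n) * (3 * - int (Suc n) - 1) = - int n * (3 * - int n - 1) + (int (3 * n + 2)) * 2"
      by (simp add: algebra_simps)
    then have e: "- int (Suc n) * (3 * - int (Suc n) - 1) div 2 = - int n * (3 * - int n - 1) div 2 + int (3 * n + 2)"
      by (simp only: div_mult_self1)
    have "y powi (- int (Suc n)) = inverse y * y powi (- int n)"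
      by (simp add: power_int_minus del: of_nat_Suc)
    then show ?thesis
      unfolding h_def e p_add by (simp only: mult_ac)
  qed
  moreover have "(\<lambda>n. inverse y * p ^ (3 * n + 2)) \<longlonglongrightarrow> 0"
    using lim by (rule tendsto_mult_right_zero)
  ultimately have "summable (\<lambda>n. norm (h (- int n)))"
    by (rule summable_norm_ratio)
  then have 2: "(\<lambda>n. norm (h (- int n))) summable_on UNIV"
    by (intro norm_summable_imp_summable_on) simp
  show ?thesis
    using summable_on_int_from_nat[of "\<lambda>k. norm (h k)", OF 1 2] unfolding h_def .
qed

lemma filterlim_nat_shift: "filterlim (\<lambda>m. nat (int m + k)) sequentially sequentially"
  unfolding filterlim_at_top eventually_sequentially
proof
  fix Z :: nat
  show "\<exists>N. \<forall>n\<ge>N. Z \<le> nat (int n + k)"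
    by (intro exI[of _ "Z + nat \<bar>k\<bar>"]) auto
qed

text \<open>Limit of \<open>quintuple_product_finite_symmetric\<close> as m grows. The finite
  products and reciprocals are bounded, so the norm of \<open>h\<close> times a constant is a
  majorant.\<close>

lemma quintuple_product_quotient:
  fixes x p :: complex
  assumes p: "p \<noteq> 0" "norm p < 1" and x: "x \<noteq> 0" "\<And>i. x\<^sup>2 * p powi i \<noteq> 1"
  shows "(\<Sum>\<^sub>\<infinity>k. (1 + x * p powi k) * (- (x ^ 3)) powi k * p powi (k * (3 * k - 1) div 2)) *
     (qfac_inf x p * qfac_inf (p / x) p) = qfac_inf p p * qfac_inf (x\<^sup>2) p * qfac_inf (p / x\<^sup>2) p"
proof -
  define h where "h k = (1 + x * p powi k) * (- (x ^ 3)) powi k * p powi (k * (3 * k - 1) div 2)" for k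
  \<comment> \<open>Limit of the m-dependent factor: the three (p;p) products come from (p;p)_{2m}
    and from the reciprocals at m + k and m - k.\<close>
  define L where "L = qfac_inf p p * (1 / qfac_inf p p) * (1 / qfac_inf p p) /
    (qfac_inf (x\<^sup>2) p * qfac_inf (p / x\<^sup>2) p)"
  define f where "f m k = h k * (qbin p (2 * m) (int m + k)
      / (qfac (x\<^sup>2) p (nat (int m + k + 1)) * qfac (p / x\<^sup>2) p (nat (int m - k))))" for m k
  \<comment> \<open>All four follow from the one condition over integer powers: p / x^2 needs a
    negative exponent, while x and p / x are squared first.\<close>
  have nz: "x\<^sup>2 * p ^ i \<noteq> 1" "p / x\<^sup>2 * p ^ i \<noteq> 1" "x * p ^ i \<noteq> 1" "p / x * p ^ i \<noteq> 1" for i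
  proof -
    show "x\<^sup>2 * p ^ i \<noteq> 1"
      using x(2)[of "int i"] by simp
    show "p / x\<^sup>2 * p ^ i \<noteq> 1"
    proof
      assume "p / x\<^sup>2 * p ^ i = 1"
      then have "x\<^sup>2 = p ^ Suc i"
        using x(1) by (simp add: field_simps)
      then have "x\<^sup>2 * p powi (- int (Suc i)) = 1"
        using p(1) by (simp only: power_int_minus power_int_of_nat) (simp add: field_simps)
      then show False
        using x(2) by blast
    qed
    show "x * p ^ i \<noteq> 1"
    proof
      assume "x * p ^ i = 1"
      then have "(x * p ^ i)\<^sup>2 = 1"
        by simp
      then have "x\<^sup>2 * p powi (int (2 * i)) = 1"
        by (simp only: power_int_of_nat) (simp add: power_mult_distrib power_mult[symmetric] mult.commute)
      then show False
        using x(2) by blast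
    qed
    show "p / x * p ^ i \<noteq> 1"
    proof
      assume "p / x * p ^ i = 1"
      then have "x = p ^ Suc i"
        using x(1) by (simp add: field_simps)
      then have "x\<^sup>2 = p ^ (2 * Suc i)"
        by (simp only: power_mult[symmetric] mult.commute)
      then have "x\<^sup>2 * p powi (- int (2 * Suc i)) = 1"
        using p(1) by (simp only: power_int_minus power_int_of_nat) (simp add: field_simps)
      then show False
        using x(2) by blast
    qed
  qed
  obtain C0 where C0: "C0 > 0" "\<And>n. norm (qfac p p n) \<le> C0"
    using qfac_bounded[OF p(2)] by blast
  obtain C1 where C1: "C1 > 0" "\<And>n. norm (rqfac p n) \<le> C1"
    using rqfac_bounded[OF p] by blast
  obtain C2 where C2: "C2 > 0" "\<And>n. norm (1 / qfac (x\<^sup>2) p n) \<le> C2"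
    using inverse_qfac_bounded[OF p(2) nz(1)] by blast
  obtain C3 where C3: "C3 > 0" "\<And>n. norm (1 / qfac (p / x\<^sup>2) p n) \<le> C3"
    using inverse_qfac_bounded[OF p(2) nz(2)] by blast
  have fb: "norm (f m k) \<le> norm (h k) * (C0 * C1 * C1 * C2 * C3)" for m k
  proof -
    have "f m k = h k * (qfac p p (2 * m) * rqfac p (int m + k) * rqfac p (int (2 * m) - (int m + k))
      * (1 / qfac (x\<^sup>2) p (nat (int m + k + 1))) * (1 / qfac (p / x\<^sup>2) p (nat (int m - k))))"
      by (simp add: f_def qbin_def)
    then show ?thesis
      using C0(1) C1(1) C2(1) C3(1)
      by (simp only: norm_mult) (intro mult_mono C0 C1 C2 C3 order_refl mult_nonneg_nonneg norm_ge_zero less_imp_le)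
  qed
  \<comment> \<open>The factor 1 + x p^k is split and p^k absorbed into the base of the k-th power,
    since p^k alone is unbounded for negative k.\<close>
  have "(\<lambda>k. norm ((- (x ^ 3)) powi k * p powi (k * (3 * k - 1) div 2))
      + norm x * norm ((- (x ^ 3) * p) powi k * p powi (k * (3 * k - 1) div 2))) summable_on UNIV"
    using p x(1) by (intro summable_on_add summable_on_cmult_right summable_pentagonal_theta) auto
  moreover have "norm (h k) \<le> norm ((- (x ^ 3)) powi k * p powi (k * (3 * k - 1) div 2))
      + norm x * norm ((- (x ^ 3) * p) powi k * p powi (k * (3 * k - 1) div 2))" for k
  proof -
    have "h k = (- (x ^ 3)) powi k * p powi (k * (3 * k - 1) div 2)
      + x * ((- (x ^ 3) * p) powi k * p powi (k * (3 * k - 1) div 2))"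
      unfolding h_def power_int_mult_distrib by (simp add: algebra_simps)
    then show ?thesis
      unfolding norm_mult[of x, symmetric] by (simp only: norm_triangle_ineq)
  qed
  ultimately have "(\<lambda>k. norm (h k)) summable_on UNIV"
    by (rule summable_on_comparison_test) auto
  then have hs: "h summable_on UNIV" and w: "(\<lambda>k. norm (h k) * (C0 * C1 * C1 * C2 * C3)) summable_on UNIV"
    using abs_summable_summable summable_on_cmult_left by blast+
  have rlim: "(\<lambda>m. rqfac p (int m + k)) \<longlonglongrightarrow> 1 / qfac_inf p p" for k
  proof -
    have "(\<lambda>m. 1 / qfac p p (nat (int m + k))) \<longlonglongrightarrow> 1 / qfac_inf p p"
      using qfac_inf_self_neq_0[OF p]
      by (intro tendsto_divide tendsto_const filterlim_compose[OF qfac_tendsto[OF p(2)] filterlim_nat_shift])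
    \<comment> \<open>While m + k < 0 the two sides differ (0 against 1), so they agree only
      eventually.\<close>
    moreover have "eventually (\<lambda>m. rqfac p (int m + k) = 1 / qfac p p (nat (int m + k))) sequentially"
      using eventually_ge_at_top[of "nat (- k)"] by eventually_elim (auto simp: rqfac_def)
    ultimately show ?thesis
      by (simp add: tendsto_cong)
  qed
  have flim: "(\<lambda>m. f m k) \<longlonglongrightarrow> h k * L" for k
  proof -
    have e: "int (2 * m) - (int m + k) = int m + - k" "int m - k = int m + - k" "int m + k + 1 = int m + (k + 1)" for m
      by simp_all
    have "filterlim (\<lambda>m. 2 * m) sequentially sequentially"
      by (intro filterlim_subseq) (simp add: strict_mono_def)
    then show ?thesis
      unfolding f_def L_def qbin_def e using qfac_inf_neq_0[OF p(2) nz(1)] qfac_inf_neq_0[OF p(2) nz(2)]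
      by (intro tendsto_mult tendsto_divide tendsto_const rlim filterlim_compose[OF qfac_tendsto[OF p(2)]]
          filterlim_nat_shift) auto
  qed
  have "infsum (f m) UNIV = 1 / (qfac x p (Suc m) * qfac (p / x) p m)" for m
    using quintuple_product_finite_symmetric[OF p x, of m] unfolding f_def h_def
    by (intro infsumI) (simp add: mult.assoc)
  moreover have "(\<lambda>m. infsum (f m) UNIV) \<longlonglongrightarrow> infsum (\<lambda>k. h k * L) UNIV"
    using infsum_dominated_convergence(2)[OF w fb flim] .
  moreover have "(\<lambda>m. 1 / (qfac x p (Suc m) * qfac (p / x) p m)) \<longlonglongrightarrow> 1 / (qfac_inf x p * qfac_inf (p / x) p)"
    using qfac_inf_neq_0[OF p(2) nz(3)] qfac_inf_neq_0[OF p(2) nz(4)]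
    by (intro tendsto_divide tendsto_mult tendsto_const qfac_tendsto p LIMSEQ_Suc) auto
  ultimately have "infsum (\<lambda>k. h k * L) UNIV = 1 / (qfac_inf x p * qfac_inf (p / x) p)"
    using LIMSEQ_unique by fastforce
  moreover have "infsum (\<lambda>k. h k * L) UNIV = infsum h UNIV * L"
    using hs by (intro infsum_cmult_left)
  ultimately have "infsum h UNIV * L * (qfac_inf x p * qfac_inf (p / x) p) = 1"
    using qfac_inf_neq_0[OF p(2) nz(3)] qfac_inf_neq_0[OF p(2) nz(4)] by simp
  then show ?thesis
    unfolding L_def h_def[symmetric]
    using qfac_inf_neq_0[OF p(2) nz(1)] qfac_inf_neq_0[OF p(2) nz(2)] qfac_inf_self_neq_0[OF p]
    by (simp add: field_simps)
qed

section \<open>From the quotient form to the product form\<close>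

lemma qfac_even_odd: "qfac a p (2 * n) = qfac a (p\<^sup>2) n * qfac (a * p) (p\<^sup>2) n"
  by (induction n) (simp_all add: qfac_Suc power_mult[symmetric] power_add mult_ac)

lemma qfac_square: "qfac (a\<^sup>2) (p\<^sup>2) n = qfac a p n * qfac (- a) p n"
proof (induction n)
  case (Suc n)
  have "1 - a\<^sup>2 * (p\<^sup>2) ^ n = (1 - a * p ^ n) * (1 - - a * p ^ n)"
    by (simp add: power_mult[symmetric] power2_eq_square power_mult_distrib algebra_simps power_mult)
  then show ?case
    unfolding qfac_Suc Suc.IH by simp
qed simp

lemma norm_power2_less_1: "norm p < 1 \<Longrightarrow> norm (p\<^sup>2 :: complex) < 1"
  by (simp add: norm_power power_less_one_iff)

lemma qfac_inf_even_odd: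
  assumes "norm p < 1"
  shows "qfac_inf a p = qfac_inf a (p\<^sup>2) * qfac_inf (a * p) (p\<^sup>2)"
proof (rule LIMSEQ_unique)
  show "(\<lambda>n. qfac a p (2 * n)) \<longlonglongrightarrow> qfac_inf a p"
    by (rule filterlim_compose[OF qfac_tendsto[OF assms]], intro filterlim_subseq) (simp add: strict_mono_def)
  show "(\<lambda>n. qfac a p (2 * n)) \<longlonglongrightarrow> qfac_inf a (p\<^sup>2) * qfac_inf (a * p) (p\<^sup>2)"
    unfolding qfac_even_odd by (intro tendsto_mult qfac_tendsto norm_power2_less_1 assms)
qed

lemma qfac_inf_square:
  assumes "norm p < 1"
  shows "qfac_inf (a\<^sup>2) (p\<^sup>2) = qfac_inf a p * qfac_inf (- a) p"
proof (rule LIMSEQ_unique)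
  show "(\<lambda>n. qfac (a\<^sup>2) (p\<^sup>2) n) \<longlonglongrightarrow> qfac_inf (a\<^sup>2) (p\<^sup>2)"
    by (intro qfac_tendsto norm_power2_less_1 assms)
  show "(\<lambda>n. qfac (a\<^sup>2) (p\<^sup>2) n) \<longlonglongrightarrow> qfac_inf a p * qfac_inf (- a) p"
    unfolding qfac_square by (intro tendsto_mult qfac_tendsto assms)
qed

text \<open>The quotient form at x = -z. Splitting (z^2;p) into even and odd factors gives
  (z;p)(-z;p)(p z^2;p^2), and (p/z^2;p) splits alike; the factors with -z cancel against the
  left-hand side.\<close>

lemma quintuple_product:
  fixes z p :: complex
  assumes p: "p \<noteq> 0" "norm p < 1" and z: "z \<noteq> 0" "\<And>i. z\<^sup>2 * p powi i \<noteq> 1"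
  shows "(\<Sum>\<^sub>\<infinity>k. (1 - z * p powi k) * (z ^ 3) powi k * p powi (k * (3 * k - 1) div 2)) =
    qfacs_inf [z, p / z, p] p * qfacs_inf [p / z\<^sup>2, p * z\<^sup>2] (p\<^sup>2)"
proof -
  let ?S = "\<Sum>\<^sub>\<infinity>k. (1 - z * p powi k) * (z ^ 3) powi k * p powi (k * (3 * k - 1) div 2)"
  let ?c = "qfac_inf (- z) p * qfac_inf (p / - z) p"
  have "?S * ?c = qfac_inf p p * qfac_inf (z\<^sup>2) p * qfac_inf (p / z\<^sup>2) p"
    using quintuple_product_quotient[OF p, of "- z"] z by simp
  also have "qfac_inf (z\<^sup>2) p = qfac_inf z p * qfac_inf (- z) p * qfac_inf (p * z\<^sup>2) (p\<^sup>2)"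
    using qfac_inf_even_odd[OF p(2), of "z\<^sup>2"] qfac_inf_square[OF p(2), of z] by (simp add: mult.commute)
  also have "qfac_inf (p / z\<^sup>2) p = qfac_inf (p / z\<^sup>2) (p\<^sup>2) * (qfac_inf (p / z) p * qfac_inf (p / - z) p)"
    using qfac_inf_even_odd[OF p(2), of "p / z\<^sup>2"] qfac_inf_square[OF p(2), of "p / z"]
    by (simp add: power2_eq_square)
  finally have "?S * ?c = qfacs_inf [z, p / z, p] p * qfacs_inf [p / z\<^sup>2, p * z\<^sup>2] (p\<^sup>2) * ?c"
    by (simp add: qfacs_inf_def mult_ac)
  moreover have "?c \<noteq> 0"
  proof -
    have "- z * p ^ i \<noteq> 1" for i
    proof
      assume "- z * p ^ i = 1"
      then have "(- z * p ^ i)\<^sup>2 = 1"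
        by simp
      then have "z\<^sup>2 * p powi (int (2 * i)) = 1"
        by (simp only: power_int_of_nat) (simp add: power_mult_distrib power_mult[symmetric] mult.commute)
      then show False
        using z(2) by blast
    qed
    moreover have "p / - z * p ^ i \<noteq> 1" for i
    proof
      assume "p / - z * p ^ i = 1"
      then have "- z = p ^ Suc i"
        using z(1) by (auto simp: field_simps)
      then have "(- z)\<^sup>2 = p ^ (2 * Suc i)"
        by (simp only: power_mult[symmetric] mult.commute)
      then have "z\<^sup>2 * p powi (- int (2 * Suc i)) = 1"
        using p(1) by (simp only: power_int_minus power_int_of_nat power2_minus) (simp add: field_simps)
      then show False
        using z(2) by blast
    qed
    ultimately show ?thesis
      using p(2) by (simp add: qfac_inf_neq_0)
  qed
  ultimately show ?thesis
    by simp
qed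

section \<open>Specialisation to powers of q: base q^10 with z = q^3 and z = q\<close>

context
  fixes q :: complex
  assumes q0: "q \<noteq> 0" and q1: "norm q < 1"
begin

lemma powi_neq_1: "i \<noteq> 0 \<Longrightarrow> q powi i \<noteq> 1"
proof (cases "i > 0")
  case True
  then show ?thesis
    using power_neq_1[OF q0 q1, of "nat i"] by (simp add: power_int_nonneg_exp)
next
  case False
  moreover assume "i \<noteq> 0"
  ultimately show ?thesis
    using power_neq_1[OF q0 q1, of "nat (- i)"] by (simp add: power_int_def power_inverse)
qed

lemma quintuple_product_power:
  assumes b: "b > 0" and ab: "\<And>i. 2 * int a + int b * i \<noteq> 0"
  shows "(\<Sum>\<^sub>\<infinity>k. q powi (int b * (k * (3 * k - 1) div 2) + 3 * int a * k)
      - q powi (int b * (k * (3 * k - 1) div 2) + 3 * int a * k + int b * k + int a)) =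
    qfacs_inf [q ^ a, q ^ b / q ^ a, q ^ b] (q ^ b) * qfacs_inf [q ^ b / q ^ (2 * a), q ^ b * q ^ (2 * a)] (q ^ (2 * b))"
proof -
  have "(q ^ a)\<^sup>2 * (q ^ b) powi i \<noteq> 1" for i
  proof -
    have "(q ^ a)\<^sup>2 * (q ^ b) powi i = q powi (2 * int a + int b * i)"
      using q0 power_int_power[of q a 2] by (simp add: power_int_add power_int_power mult.commute)
    then show ?thesis
      using powi_neq_1[OF ab] by simp
  qed
  moreover have "norm (q ^ b) < 1"
    using b q1 by (simp add: norm_power power_less_one_iff)
  moreover have "(1 - q ^ a * (q ^ b) powi k) * ((q ^ a) ^ 3) powi k * (q ^ b) powi (k * (3 * k - 1) div 2) =
      q powi (int b * (k * (3 * k - 1) div 2) + 3 * int a * k)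
      - q powi (int b * (k * (3 * k - 1) div 2) + 3 * int a * k + int b * k + int a)" for k
  proof -
    have "((q ^ a) ^ 3) powi k = q powi (3 * int a * k)"
      by (simp add: power_mult[symmetric] power_int_power mult.commute)
    then show ?thesis
      using q0 by (simp add: power_int_add power_int_power algebra_simps)
  qed
  ultimately show ?thesis
    using quintuple_product[of "q ^ b" "q ^ a"] q0 by (simp add: power_mult[symmetric] mult.commute)
qed

lemma
  shows sum_odd_product: "(\<lambda>n. q ^ (n\<^sup>2 + n) / qfac q q (2 * n + 1)) sums
      (qfacs_inf [q ^ 3, q ^ 7, q ^ 10] (q ^ 10) * qfacs_inf [q ^ 4, q ^ 16] (q ^ 20) / qfac_inf q q)"
    and sum_even_product: "(\<lambda>n. q ^ (n\<^sup>2 + n) / qfac q q (2 * n)) sums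
      (qfacs_inf [q, q ^ 9, q ^ 10] (q ^ 10) * qfacs_inf [q ^ 8, q ^ 12] (q ^ 20) / qfac_inf q q)"
proof -
  have d: "2 * (k * (3 * k - 1) div 2) = k * (3 * k - 1)" for k :: int
    by simp
  have e: "10 * (k * (3 * k - 1) div 2) = 15 * k\<^sup>2 - 5 * k" for k :: int
  proof -
    define t where "t = k * (3 * k - 1) div 2"
    then have "2 * t = 3 * k\<^sup>2 - k"
      using d[of k] by (simp add: algebra_simps power2_eq_square)
    then show ?thesis
      unfolding t_def[symmetric] by linarith
  qed
  \<comment> \<open>\<open>int 10\<close> and \<open>int 3\<close> stay unevaluated to match the
    instance of \<open>quintuple_product_power\<close>; the second equation rewrites the output of
    the first.\<close>
  have e3: "int 10 * (k * (3 * k - 1) div 2) + 3 * int 3 * k = 15 * k\<^sup>2 + 4 * k"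
    "15 * k\<^sup>2 + 4 * k + int 10 * k + int 3 = 15 * k\<^sup>2 + 14 * k + 3" for k :: int
    using e[of k] by simp_all
  have e1: "int 10 * (k * (3 * k - 1) div 2) + 3 * int 1 * k = 15 * k\<^sup>2 - 2 * k"
    "15 * k\<^sup>2 - 2 * k + int 10 * k + int 1 = 15 * k\<^sup>2 + 8 * k + 1" for k :: int
    using e[of k] by simp_all
  have q: "q ^ 10 / q ^ 3 = q ^ 7" "q ^ 10 / q ^ 6 = q ^ 4" "q ^ 10 / q = q ^ 9" "q ^ 10 / q ^ 2 = q ^ 8"
    using power_diff[OF q0, of 3 10] power_diff[OF q0, of 6 10] power_diff[OF q0, of 1 10] power_diff[OF q0, of 2 10]
    by simp_all
  have ne: "2 * int 3 + int 10 * i \<noteq> 0" "2 * int 1 + int 10 * i \<noteq> 0" for i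
    by presburger+
  have "(\<Sum>\<^sub>\<infinity>k. q powi (15 * k\<^sup>2 + 4 * k) - q powi (15 * k\<^sup>2 + 14 * k + 3)) =
      qfacs_inf [q ^ 3, q ^ 7, q ^ 10] (q ^ 10) * qfacs_inf [q ^ 4, q ^ 16] (q ^ 20)"
    using quintuple_product_power[where a = 3 and b = 10, OF _ ne(1)] unfolding e3
    by (simp add: q power_add[symmetric])
  moreover have "(\<Sum>\<^sub>\<infinity>k. q powi (15 * k\<^sup>2 - 2 * k) - q powi (15 * k\<^sup>2 + 8 * k + 1)) =
      qfacs_inf [q, q ^ 9, q ^ 10] (q ^ 10) * qfacs_inf [q ^ 8, q ^ 12] (q ^ 20)"
    using quintuple_product_power[where a = 1 and b = 10, OF _ ne(2)] unfolding e1
    by (simp add: q power_add[symmetric])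
  ultimately show "(\<lambda>n. q ^ (n\<^sup>2 + n) / qfac q q (2 * n + 1)) sums
      (qfacs_inf [q ^ 3, q ^ 7, q ^ 10] (q ^ 10) * qfacs_inf [q ^ 4, q ^ 16] (q ^ 20) / qfac_inf q q)"
    "(\<lambda>n. q ^ (n\<^sup>2 + n) / qfac q q (2 * n)) sums
      (qfacs_inf [q, q ^ 9, q ^ 10] (q ^ 10) * qfacs_inf [q ^ 8, q ^ 12] (q ^ 20) / qfac_inf q q)"
    using sum_odd_theta[OF q0 q1] sum_even_theta[OF q0 q1] by simp_all
qed

end

section \<open>The two families of series\<close>

context
  fixes q :: complex
  assumes q0: "q \<noteq> 0" and q1: "norm q < 1"
begin

definition odd_sum :: "nat \<Rightarrow> complex" where
  "odd_sum m = (\<Sum>n. q ^ (n\<^sup>2 + (2 * m + 1) * n) / qfac q q (2 * n + 1))"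

definition even_sum :: "nat \<Rightarrow> complex" where
  "even_sum m = (\<Sum>n. q ^ (n\<^sup>2 + (2 * m + 1) * n) / qfac q q (2 * n))"

lemma summable_qfac_series: "summable (\<lambda>n. q ^ (n\<^sup>2 + (2 * m + 1) * n) / qfac q q (a n))"
proof -
  obtain C where C: "C > 0" "\<And>k. norm (rqfac q k) \<le> C"
    using rqfac_bounded[OF q0 q1] by blast
  have "norm (q ^ (n\<^sup>2 + (2 * m + 1) * n) / qfac q q (a n)) \<le> norm q ^ n * C" for n
  proof -
    have "norm (q ^ (n\<^sup>2 + (2 * m + 1) * n)) \<le> norm q ^ n"
      unfolding norm_power using q1 by (intro power_decreasing) auto
    then have "norm (q ^ (n\<^sup>2 + (2 * m + 1) * n)) * norm (rqfac q (int (a n))) \<le> norm q ^ n * C"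
      using C(1) by (intro mult_mono C) auto
    then show ?thesis
      by (simp add: norm_divide norm_mult)
  qed
  moreover have "summable (\<lambda>n. norm q ^ n * C)"
    using q1 by (intro summable_mult2 summable_geometric) simp
  ultimately show ?thesis
    by (rule summable_comparison_test'[rotated, where N = 0])
qed

lemma odd_sum_sums: "(\<lambda>n. q ^ (n\<^sup>2 + (2 * m + 1) * n) / qfac q q (2 * n + 1)) sums odd_sum m"
  unfolding odd_sum_def by (intro summable_sums summable_qfac_series)

lemma even_sum_sums: "(\<lambda>n. q ^ (n\<^sup>2 + (2 * m + 1) * n) / qfac q q (2 * n)) sums even_sum m"
  unfolding even_sum_def by (intro summable_sums summable_qfac_series)

text \<open>Termwise 1/(q;q)_{2n} = (1 - q^(2n+1))/(q;q)_{2n+1}, and a factor q^(2n) raises m by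
  one.\<close>

lemma even_sum_eq: "even_sum m = odd_sum m - q * odd_sum (Suc m)"
proof (rule sums_unique2[OF even_sum_sums])
  have "q ^ (n\<^sup>2 + (2 * m + 1) * n) / qfac q q (2 * n) = q ^ (n\<^sup>2 + (2 * m + 1) * n) / qfac q q (2 * n + 1)
      - q * (q ^ (n\<^sup>2 + (2 * Suc m + 1) * n) / qfac q q (2 * n + 1))" for n
  proof -
    have "q * q ^ (n\<^sup>2 + (2 * Suc m + 1) * n) = q ^ (n\<^sup>2 + (2 * m + 1) * n) * (q * q ^ (2 * n))"
      by (simp add: power_add[symmetric] algebra_simps flip: power_Suc)
    then have "q ^ (n\<^sup>2 + (2 * m + 1) * n) - q * q ^ (n\<^sup>2 + (2 * Suc m + 1) * n)
        = q ^ (n\<^sup>2 + (2 * m + 1) * n) * (1 - q * q ^ (2 * n))"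
      by (simp only: right_diff_distrib mult_1_right)
    then show ?thesis
      using qfac_neq_0[OF q0 q1, of "Suc (2 * n)"]
      unfolding Suc_eq_plus1[symmetric] qfac_Suc times_divide_eq_right diff_divide_distrib[symmetric] by simp
  qed
  then show "(\<lambda>n. q ^ (n\<^sup>2 + (2 * m + 1) * n) / qfac q q (2 * n)) sums (odd_sum m - q * odd_sum (Suc m))"
    by (simp only:) (intro sums_diff sums_mult odd_sum_sums)
qed

text \<open>The difference carries the factor 1 - q^(2n), which removes the term n = 0 and cancels
  the last factor of (q;q)_{2n} otherwise; a shift of n gives the odd series.\<close>

lemma even_sum_diff: "even_sum m - even_sum (Suc m) = q ^ (2 * m + 2) * odd_sum (Suc m)"
proof (rule sums_unique2)
  let ?g = "\<lambda>n. q ^ (n\<^sup>2 + (2 * m + 1) * n) / qfac q q (2 * n) - q ^ (n\<^sup>2 + (2 * Suc m + 1) * n) / qfac q q (2 * n)"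
  show "?g sums (even_sum m - even_sum (Suc m))"
    by (intro sums_diff even_sum_sums)
  have "?g (Suc n) = q ^ (2 * m + 2) * (q ^ (n\<^sup>2 + (2 * Suc m + 1) * n) / qfac q q (2 * n + 1))" for n
  proof -
    have e: "(Suc n)\<^sup>2 + (2 * m + 1) * Suc n = (2 * m + 2) + (n\<^sup>2 + (2 * Suc m + 1) * n)"
      "(Suc n)\<^sup>2 + (2 * Suc m + 1) * Suc n = (2 * m + 2) + (n\<^sup>2 + (2 * Suc m + 1) * n) + Suc (2 * n + 1)"
      by (simp_all add: power2_eq_square algebra_simps)
    have f: "qfac q q (2 * Suc n) = qfac q q (2 * n + 1) * (1 - q ^ Suc (2 * n + 1))"
      by (simp add: qfac_Suc)
    have "1 - q ^ Suc (2 * n + 1) \<noteq> 0"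
      using power_neq_1[OF q0 q1, of "Suc (2 * n + 1)"] by simp
    moreover have "?g (Suc n) = q ^ (2 * m + 2) * q ^ (n\<^sup>2 + (2 * Suc m + 1) * n) * (1 - q ^ Suc (2 * n + 1))
        / qfac q q (2 * Suc n)"
      unfolding e power_add[of q _ "Suc (2 * n + 1)"] power_add[of q "2 * m + 2"]
      by (simp only: diff_divide_distrib[symmetric] right_diff_distrib mult_1_right)
    ultimately show ?thesis
      unfolding f by simp
  qed
  then have "(\<lambda>n. ?g (Suc n)) sums (q ^ (2 * m + 2) * odd_sum (Suc m))"
    by (simp only:) (intro sums_mult odd_sum_sums)
  then show "?g sums (q ^ (2 * m + 2) * odd_sum (Suc m))"
    by (subst (asm) sums_Suc_iff) simp
qed

text \<open>Eliminates the even series from the two coupling relations. The weight q^m brings the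
  result to the recurrence of P and Q at index m + 1, and is the origin of q^(-m) in the
  theorem.\<close>

lemma odd_sum_rec:
  "q ^ Suc (Suc m) * odd_sum (Suc (Suc m)) =
    (1 + q + q ^ (2 * m + 2)) * (q ^ Suc m * odd_sum (Suc m)) - q * (q ^ m * odd_sum m)"
proof -
  have "q * odd_sum (Suc (Suc m)) = odd_sum (Suc m) - (even_sum m - q ^ (2 * m + 2) * odd_sum (Suc m))"
    using even_sum_eq[of "Suc m"] even_sum_diff[of m] by (simp add: algebra_simps)
  then have *: "q * odd_sum (Suc (Suc m)) = (1 + q + q ^ (2 * m + 2)) * odd_sum (Suc m) - odd_sum m"
    unfolding even_sum_eq[of m] by (simp add: algebra_simps)
  have "q ^ Suc (Suc m) * odd_sum (Suc (Suc m)) = q ^ Suc m * (q * odd_sum (Suc (Suc m)))"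
    by simp
  then show ?thesis
    unfolding * by (simp add: algebra_simps)
qed

lemma even_sum_rec:
  "even_sum (Suc (Suc m)) = (1 + q + q ^ (2 * m + 3)) * even_sum (Suc m) - q * even_sum m"
proof -
  have "2 * Suc m + 2 = Suc (2 * m + 3)"
    by simp
  then have "even_sum (Suc (Suc m)) = even_sum (Suc m) - q ^ (2 * m + 3) * (q * odd_sum (Suc (Suc m)))"
    using even_sum_diff[of "Suc m"] by (simp only: power_Suc) (simp add: algebra_simps)
  also have "q * odd_sum (Suc (Suc m)) = odd_sum (Suc m) - even_sum (Suc m)"
    using even_sum_eq[of "Suc m"] by simp
  also have "q ^ (2 * m + 3) * (odd_sum (Suc m) - even_sum (Suc m)) =
      q * (q ^ (2 * m + 2) * odd_sum (Suc m)) - q ^ (2 * m + 3) * even_sum (Suc m)"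
    by (simp add: algebra_simps power_add numeral_3_eq_3)
  finally show ?thesis
    unfolding even_sum_diff[of m, symmetric] by (simp add: algebra_simps)
qed

text \<open>Both sides obey the same recurrence. The values at -1 settle m = 0, and
  \<open>even_sum_eq\<close> settles m = 1.\<close>

lemma odd_sum_eq:
  fixes P Q :: "int \<Rightarrow> complex"
  assumes P: "P (-1) = 0" "P 0 = 1" "P 1 = 1 + q + q ^ 2"
      "\<And>m. m \<ge> 2 \<Longrightarrow> P m = (1 + q + q powi (2 * m)) * P (m - 1) - q * P (m - 2)"
    and Q: "Q (-1) = 1" "Q 0 = 1" "Q 1 = 1 + q ^ 2"
      "\<And>m. m \<ge> 2 \<Longrightarrow> Q m = (1 + q + q powi (2 * m)) * Q (m - 1) - q * Q (m - 2)"
  shows "q ^ m * odd_sum m = odd_sum 0 * Q (int m - 1) - even_sum 0 * P (int m - 1)"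
proof (induction m rule: induct_nat_012)
  case 1
  show ?case
    using even_sum_eq[of 0] P Q by simp
next
  case (ge2 n)
  have e: "q powi (2 * (int n + 1)) = q ^ (2 * n + 2)"
    using power_int_of_nat[of q "2 * n + 2"] by (simp only: of_nat_add of_nat_mult of_nat_numeral) (simp add: algebra_simps)
  \<comment> \<open>For n = 0 this is the recurrence at index 1, below the assumed range; there the
    initial values satisfy it directly.\<close>
  have "P (int n + 1) = (1 + q + q ^ (2 * n + 2)) * P (int n) - q * P (int n - 1)"
    using P(1-3) P(4)[of "int n + 1"] unfolding e by (cases "n = 0") (simp_all add: algebra_simps power2_eq_square)
  moreover have "Q (int n + 1) = (1 + q + q ^ (2 * n + 2)) * Q (int n) - q * Q (int n - 1)"
    using Q(1-3) Q(4)[of "int n + 1"] unfolding e by (cases "n = 0") (simp_all add: algebra_simps power2_eq_square)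
  moreover have "int (Suc (Suc n)) - 1 = int n + 1" "int (Suc n) - 1 = int n"
    by simp_all
  ultimately show ?case
    unfolding odd_sum_rec using ge2 by (simp only:) (simp add: algebra_simps)
qed (use P Q in simp)

lemma even_sum_eq_combination:
  fixes A B :: "nat \<Rightarrow> complex"
  assumes A: "A 0 = 1" "A 1 = 1 + q"
      "\<And>m. m \<ge> 2 \<Longrightarrow> A m = (1 + q + q ^ (2 * m - 1)) * A (m - 1) - q * A (m - 2)"
    and B: "B 0 = 0" "B 1 = q"
      "\<And>m. m \<ge> 2 \<Longrightarrow> B m = (1 + q + q ^ (2 * m - 1)) * B (m - 1) - q * B (m - 2)"
  shows "even_sum m = even_sum 0 * A m - odd_sum 0 * B m"
proof (induction m rule: induct_nat_012)
  case 1
  have "q\<^sup>2 * odd_sum 1 = q * (odd_sum 0 - even_sum 0)"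
    using even_sum_eq[of 0] by (simp add: power2_eq_square)
  then show ?case
    using even_sum_diff[of 0] A B by (simp add: algebra_simps numeral_2_eq_2)
next
  case (ge2 n)
  have e: "2 * Suc (Suc n) - 1 = 2 * n + 3"
    by simp
  have "A (Suc (Suc n)) = (1 + q + q ^ (2 * n + 3)) * A (Suc n) - q * A n"
    "B (Suc (Suc n)) = (1 + q + q ^ (2 * n + 3)) * B (Suc n) - q * B n"
    using A(3)[of "Suc (Suc n)", unfolded e] B(3)[of "Suc (Suc n)", unfolded e] by simp_all
  then show ?case
    unfolding even_sum_rec ge2 by (simp only:) (simp add: algebra_simps)
qed (use A B in simp)

lemma odd_sum_0: "odd_sum 0 =
    qfacs_inf [q ^ 3, q ^ 7, q ^ 10] (q ^ 10) * qfacs_inf [q ^ 4, q ^ 16] (q ^ 20) / qfac_inf q q"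
  using sums_unique2[OF odd_sum_sums[of 0]] sum_odd_product[OF q0 q1] by simp

lemma even_sum_0: "even_sum 0 =
    qfacs_inf [q, q ^ 9, q ^ 10] (q ^ 10) * qfacs_inf [q ^ 8, q ^ 12] (q ^ 20) / qfac_inf q q"
  using sums_unique2[OF even_sum_sums[of 0]] sum_even_product[OF q0 q1] by simp

end

theorem theorem2p7:
  fixes q :: complex
  assumes "0 < norm q" and "norm q < 1"
  shows
    "(\<forall>P Q :: int \<Rightarrow> complex.
        P (-1) = 0 \<and> P 0 = 1 \<and> P 1 = 1 + q + q ^ 2 \<and>
        (\<forall>m\<ge>2. P m = (1 + q + q powi (2 * m)) * P (m - 1) - q * P (m - 2)) \<and>
        Q (-1) = 1 \<and> Q 0 = 1 \<and> Q 1 = 1 + q ^ 2 \<and>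
        (\<forall>m\<ge>2. Q m = (1 + q + q powi (2 * m)) * Q (m - 1) - q * Q (m - 2))
      \<longrightarrow>
        (\<forall>m :: nat.
          (\<lambda>n. q ^ (n ^ 2 + (2 * m + 1) * n) / qfac q q (2 * n + 1)) sums
            (q powi (- int m) * qfacs_inf [q ^ 3, q ^ 7, q ^ 10] (q ^ 10)
                * qfacs_inf [q ^ 4, q ^ 16] (q ^ 20) / qfac_inf q q * Q (int m - 1)
             - q powi (- int m) * qfacs_inf [q, q ^ 9, q ^ 10] (q ^ 10)
                * qfacs_inf [q ^ 8, q ^ 12] (q ^ 20) / qfac_inf q q * P (int m - 1))))
     \<and>
     (\<forall>A B :: nat \<Rightarrow> complex.
        A 0 = 1 \<and> A 1 = 1 + q \<and>
        (\<forall>m\<ge>2. A m = (1 + q + q ^ (2 * m - 1)) * A (m - 1) - q * A (m - 2)) \<and>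
        B 0 = 0 \<and> B 1 = q \<and>
        (\<forall>m\<ge>2. B m = (1 + q + q ^ (2 * m - 1)) * B (m - 1) - q * B (m - 2))
      \<longrightarrow>
        (\<forall>m :: nat.
          (\<lambda>n. q ^ (n ^ 2 + (2 * m + 1) * n) / qfac q q (2 * n)) sums
            (qfacs_inf [q, q ^ 9, q ^ 10] (q ^ 10)
                * qfacs_inf [q ^ 8, q ^ 12] (q ^ 20) / qfac_inf q q * A m
             - qfacs_inf [q ^ 3, q ^ 7, q ^ 10] (q ^ 10)
                * qfacs_inf [q ^ 4, q ^ 16] (q ^ 20) / qfac_inf q q * B m)))"
proof (intro conjI allI impI; elim conjE)
  have q0: "q \<noteq> 0"
    using assms by auto
  note q = q0 assms(2)
  fix P Q :: "int \<Rightarrow> complex" and m :: nat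
  assume PQ: "P (-1) = 0" "P 0 = 1" "P 1 = 1 + q + q ^ 2"
      "\<forall>m\<ge>2. P m = (1 + q + q powi (2 * m)) * P (m - 1) - q * P (m - 2)"
      "Q (-1) = 1" "Q 0 = 1" "Q 1 = 1 + q ^ 2"
      "\<forall>m\<ge>2. Q m = (1 + q + q powi (2 * m)) * Q (m - 1) - q * Q (m - 2)"
  have eq: "q ^ m * odd_sum q m = odd_sum q 0 * Q (int m - 1) - even_sum q 0 * P (int m - 1)"
    using PQ by (intro odd_sum_eq q) auto
  have "odd_sum q m = q powi (- int m) * (q ^ m * odd_sum q m)"
    using q0 by (simp add: power_int_minus)
  then have "odd_sum q m = q powi (- int m) * odd_sum q 0 * Q (int m - 1)
      - q powi (- int m) * even_sum q 0 * P (int m - 1)"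
    unfolding eq by (simp only: right_diff_distrib mult.assoc)
  then show "(\<lambda>n. q ^ (n ^ 2 + (2 * m + 1) * n) / qfac q q (2 * n + 1)) sums
            (q powi (- int m) * qfacs_inf [q ^ 3, q ^ 7, q ^ 10] (q ^ 10)
                * qfacs_inf [q ^ 4, q ^ 16] (q ^ 20) / qfac_inf q q * Q (int m - 1)
             - q powi (- int m) * qfacs_inf [q, q ^ 9, q ^ 10] (q ^ 10)
                * qfacs_inf [q ^ 8, q ^ 12] (q ^ 20) / qfac_inf q q * P (int m - 1))"
    using odd_sum_sums[OF q, of m] unfolding odd_sum_0[OF q] even_sum_0[OF q]
    by (simp only: times_divide_eq_right mult.assoc)
next
  have q0: "q \<noteq> 0"
    using assms by auto
  note q = q0 assms(2)
  fix A B :: "nat \<Rightarrow> complex" and m :: nat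
  assume AB: "A 0 = 1" "A 1 = 1 + q"
      "\<forall>m\<ge>2. A m = (1 + q + q ^ (2 * m - 1)) * A (m - 1) - q * A (m - 2)"
      "B 0 = 0" "B 1 = q"
      "\<forall>m\<ge>2. B m = (1 + q + q ^ (2 * m - 1)) * B (m - 1) - q * B (m - 2)"
  have "even_sum q m = even_sum q 0 * A m - odd_sum q 0 * B m"
    using AB by (intro even_sum_eq_combination q) auto
  then show "(\<lambda>n. q ^ (n ^ 2 + (2 * m + 1) * n) / qfac q q (2 * n)) sums
            (qfacs_inf [q, q ^ 9, q ^ 10] (q ^ 10)
                * qfacs_inf [q ^ 8, q ^ 12] (q ^ 20) / qfac_inf q q * A m
             - qfacs_inf [q ^ 3, q ^ 7, q ^ 10] (q ^ 10)
                * qfacs_inf [q ^ 4, q ^ 16] (q ^ 20) / qfac_inf q q * B m)"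
    using even_sum_sums[OF q, of m] unfolding odd_sum_0[OF q] even_sum_0[OF q] by simp
qed

end
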